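(* Let $q=e^{2\pi i z}$ and let $\eta(z)=q^{1/24}\prod_{n\ge1}(1-q^n)$ be the Dedekind eta function. Define \[ g(z)=\eta^2(4z)\eta^2(8z),\qquad L(z)=\frac{\eta^6(8z)}{\eta^2(4z)\eta^4(16z)},\qquad F(z)=-g(z)L(2z)=\sum_{n\ge -1}C(n)q^n . \] Let $p\equiv 3\pmod 4$ be prime. Then for all integers $m\ge 0$, \[ v_p\big(C(p^{2m+1})\big)=m,\qquad v_p\!\left(\frac{F\,|\,U(p^{2m+1})}{C(p^{2m+1})}-g\right)\ge m+1 . \]
   Context: For a positive integer $m$, the operator $U(m)$ acts on $q$-expansions by $\sum a(n)q^n\,|\,U(m)=\sum a(mn)q^n$. For a formal Laurent series in $q$ with rational coefficients, $v_p$ denotes the minimum of the $p$-adic valuations of its coefficients (and $v_p(0)=\infty$); for a rational number it is the usual $p$-adic valuation. The functions $g,L,F$ are identified with their $q$-expansions; $F$ has integer coefficients $C(n)$, with $F=-q^{-1}+2q^3+q^7-\cdots$. *)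

theory Defs
  imports "HOL-Computational_Algebra.Computational_Algebra" "HOL-Library.Extended_Real"
begin

text \<open>q-expansions are formal Laurent series in q with rational coefficients.\<close>

text \<open>Euler product  prod_{n>=1} (1 - q^n)  as a formal power series: its n-th coefficient
  is the n-th coefficient of the finite product over 1 <= k <= n.\<close>
definition euler_fps :: "rat fps" where
  "euler_fps = Abs_fps (\<lambda>n. fps_nth (\<Prod>k\<in>{1..n}. (1 - fps_X ^ k) :: rat fps) n)"

text \<open>E k = prod_{n>=1} (1 - q^{k n}); then eta(k z) = q^{k/24} * E k.\<close>
definition E :: "nat \<Rightarrow> rat fls" where
  "E k = fls_compose_power (fps_to_fls euler_fps) k"

text \<open>g = eta^2(4z) eta^2(8z) = q^{(8+16)/24} E4^2 E8^2 = q E4^2 E8^2.\<close>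
definition g :: "rat fls" where
  "g = fls_X * E 4 ^ 2 * E 8 ^ 2"

text \<open>L = eta^6(8z) / (eta^2(4z) eta^4(16z)) = q^{(48-8-64)/24} E8^6/(E4^2 E16^4)
  = q^{-1} E8^6/(E4^2 E16^4).\<close>
definition L :: "rat fls" where
  "L = fls_X_inv * E 8 ^ 6 / (E 4 ^ 2 * E 16 ^ 4)"

text \<open>F(z) = - g(z) L(2z); L(2z) is obtained by substituting q -> q^2.\<close>
definition F :: "rat fls" where
  "F = - g * fls_compose_power L 2"

definition C :: "int \<Rightarrow> rat" where
  "C n = fls_nth F n"

lift_definition U :: "nat \<Rightarrow> rat fls \<Rightarrow> rat fls" is
  "\<lambda>m f n. if m > 0 then f (int m * n) else 0"
proof -
  fix m :: nat and f :: "int \<Rightarrow> rat"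
  assume *: "\<forall>\<^sub>\<infinity> n::nat. f (- int n) = 0"
  show "\<forall>\<^sub>\<infinity> n::nat. (if m > 0 then f (int m * - int n) else 0) = 0"
  proof (cases "m = 0")
    case False
    from * have "eventually (\<lambda>n. f (-int n) = 0) at_top"
      by (simp add: cofinite_eq_sequentially)
    then obtain N where N: "\<And>n. n \<ge> N \<Longrightarrow> f (-int n) = 0"
      by (auto simp: eventually_at_top_linorder)
    have "eventually (\<lambda>n. (if m > 0 then f (int m * - int n) else 0) = 0) at_top"
      unfolding eventually_at_top_linorder
    proof (intro exI allI impI)
      fix n assume "n \<ge> N"
      have "n \<le> m * n" using False by simp
      with \<open>n \<ge> N\<close> have "m * n \<ge> N" by linarith
      hence "f (- int (m * n)) = 0" by (rule N)
      thus "(if m > 0 then f (int m * - int n) else 0) = 0" by simp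
    qed
    thus ?thesis by (simp add: cofinite_eq_sequentially)
  qed simp
qed

text \<open>p-adic valuation of a rational number (for x = 0 the value is irrelevant;
  it is only used for nonzero x below).\<close>
definition vp :: "nat \<Rightarrow> rat \<Rightarrow> int" where
  "vp p x = (case quotient_of x of (a, b) \<Rightarrow>
      int (multiplicity (int p) a) - int (multiplicity (int p) b))"

text \<open>p-adic valuation of a formal Laurent series: minimum over the valuations of the
  coefficients; equals infinity for the zero series.\<close>
definition vp_series :: "nat \<Rightarrow> rat fls \<Rightarrow> ereal" where
  "vp_series p f = (INF n \<in> {n. fls_nth f n \<noteq> 0}. ereal (of_int (vp p (fls_nth f n))))"

end

(*
  The function s = L(2z)^(-1/2) = q + ... has integral q-expansion, and with theta = q d/dq one has
  theta s = g * sqrt (1 + 4 s^4).  Hence g dq/q and F dq/q = - s^(-2) g dq/q are, in the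
  parameter s, the explicit differentials with coefficients (-1)^k binom(2k, k) at s^(4k) ds and
  - (-1)^k binom(2k, k) at s^(4k-2) ds.  The relation between theta s, s and g comes from the
  Jacobi triple product, the identity for the cube of the Euler product, and the rotation
  (a, b) -> (a + b, a - b) of the square lattice.

  For p = 3 (mod 4) the p-free parts of the central binomial coefficients depend p-adically
  continuously on k, so that the s-coefficients B of F and A of g satisfy
  B(pi) = gamma A(i) modulo the power of p dividing pi, for some p-adic unit gamma.  Such a
  congruence says that F - gamma g(pz) is the theta-derivative of an integral series, a property
  that is independent of the parameter since s(q)^p = s(q^p) (mod p).  Therefore
  C(p^M n) = gamma a(p^(M-1) n) (mod p^M), where a(n) are the coefficients of g.  Finally g is
  the theta series of a Hecke character of Q(i), and p is inert, so a(p^2 n) = - p a(n);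
  with M = 2m + 1 the right-hand side is gamma (-p)^m a(n).
*)

theory Submission
  imports Defs "HOL-Number_Theory.Residues"
begin

section \<open>Generating functions of weighted index sets\<close>

text \<open>In q the coefficients of the two forms cannot be compared term by term; in s they are
  hypergeometric. With j attached to s^(j-1) ds, g has only indices j = 1 (mod 4) and F, apart from
  its pole, only j = 3 (mod 4). Multiplication by p carries the first class to the second exactly
  when p = 3 (mod 4). The polar part -s^(-2) ds = d(1/s) is exact with an integral primitive, so it
  contributes a multiple of n to the coefficient of q^n.

  For p = 4c + 3 the relevant ratio is that of the central binomials at p l + c + 1 and l. The extra
  factors p on its two sides are equal in number, so it is a p-adic unit, and modulo p^(e+1) it
  depends only on l modulo p^e. If p^(e+1) divides p i with i = 4l + 1, then l is -1/4 modulo p^e;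
  all relevant ratios thus approximate the same number, which is -gamma.

  Gamma may depend on M, because it cancels in C(p^M n) / C(p^M). That quotient costs p^m of the
  precision p^(2m+1), which leaves m + 1.\<close>

definition finite_fibres :: "('x \<Rightarrow> nat) \<Rightarrow> 'x set \<Rightarrow> bool" where
  "finite_fibres h A \<longleftrightarrow> (\<forall>n. finite {x \<in> A. h x = n})"

text \<open>The theta series with terms w(x) q^h(x). Keeping the index set explicit turns a product
  of series into a sum over pairs and a lattice rotation into a reindexing. A sum over an infinite
  fibre is 0 by convention, which is why products and unions ask for
  \<open>finite_fibres\<close>.\<close>

definition gen_fun :: "('x \<Rightarrow> 'a::comm_ring_1) \<Rightarrow> ('x \<Rightarrow> nat) \<Rightarrow> 'x set \<Rightarrow> 'a fps" where
  "gen_fun w h A = Abs_fps (\<lambda>n. \<Sum>x \<in> {x \<in> A. h x = n}. w x)"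

lemma gen_fun_nth: "gen_fun w h A $ n = (\<Sum>x \<in> {x \<in> A. h x = n}. w x)"
  by (simp add: gen_fun_def)

lemma finite_fibres_int:
  fixes h :: "int \<Rightarrow> nat"
  assumes "\<And>x. x \<in> A \<Longrightarrow> \<bar>x\<bar> \<le> int (h x) + c"
  shows "finite_fibres h A"
  unfolding finite_fibres_def
proof
  fix n
  have "{x \<in> A. h x = n} \<subseteq> {-(int n + c)..int n + c}"
    using assms by fastforce
  thus "finite {x \<in> A. h x = n}" by (rule finite_subset) simp
qed

lemma finite_fibres_subset: "finite_fibres h B \<Longrightarrow> A \<subseteq> B \<Longrightarrow> finite_fibres h A"
  unfolding finite_fibres_def by (auto intro: finite_subset[of _ "{x \<in> B. h x = n}" for n])

lemma fibre_Times:
  fixes h :: "'x \<Rightarrow> nat" and k :: "'y \<Rightarrow> nat"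
  shows "{z \<in> A \<times> B. h (fst z) + k (snd z) = n} =
    (\<Union>i\<in>{0..n}. {x \<in> A. h x = i} \<times> {y \<in> B. k y = n - i})"
  by auto

lemma finite_fibres_Times:
  assumes "finite_fibres h A" "finite_fibres k B"
  shows "finite_fibres (\<lambda>z. h (fst z) + k (snd z)) (A \<times> B)"
  unfolding finite_fibres_def fibre_Times using assms by (auto simp: finite_fibres_def)

lemma gen_fun_mult:
  assumes "finite_fibres h A" "finite_fibres k B"
  shows "gen_fun w h A * gen_fun v k B =
    gen_fun (\<lambda>z. w (fst z) * v (snd z)) (\<lambda>z. h (fst z) + k (snd z)) (A \<times> B)"
proof (rule fps_ext)
  fix n
  have fin: "finite {x \<in> A. h x = i}" "finite {y \<in> B. k y = i}" for i
    using assms by (auto simp: finite_fibres_def)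
  have "gen_fun (\<lambda>z. w (fst z) * v (snd z)) (\<lambda>z. h (fst z) + k (snd z)) (A \<times> B) $ n =
      (\<Sum>i\<in>{0..n}. \<Sum>z\<in>{x \<in> A. h x = i} \<times> {y \<in> B. k y = n - i}. w (fst z) * v (snd z))"
    unfolding gen_fun_nth fibre_Times
    by (rule sum.UNION_disjoint) (auto simp: fin)
  also have "\<dots> = (\<Sum>i\<in>{0..n}. gen_fun w h A $ i * gen_fun v k B $ (n - i))"
    by (intro sum.cong refl)
       (simp add: gen_fun_nth sum_product sum.cartesian_product case_prod_beta)
  finally show "(gen_fun w h A * gen_fun v k B) $ n =
      gen_fun (\<lambda>z. w (fst z) * v (snd z)) (\<lambda>z. h (fst z) + k (snd z)) (A \<times> B) $ n"
    by (simp add: fps_mult_nth)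
qed

lemma gen_fun_reindex:
  assumes "bij_betw f A B" "\<And>x. x \<in> A \<Longrightarrow> w x = v (f x)" "\<And>x. x \<in> A \<Longrightarrow> h x = k (f x)"
  shows "gen_fun w h A = gen_fun v k B"
proof (rule fps_ext)
  fix n
  have "bij_betw f {x \<in> A. h x = n} {y \<in> B. k y = n}"
    using assms(1,3) unfolding bij_betw_def inj_on_def by (auto simp: image_iff)
  from sum.reindex_bij_betw[OF this, of v]
  show "gen_fun w h A $ n = gen_fun v k B $ n"
    unfolding gen_fun_nth using assms(2) by (metis (no_types, lifting) mem_Collect_eq sum.cong)
qed

lemma gen_fun_Un:
  assumes "finite_fibres h A" "finite_fibres h B" "A \<inter> B = {}"
  shows "gen_fun w h (A \<union> B) = gen_fun w h A + gen_fun w h B"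
proof (rule fps_ext)
  fix n
  have "{x \<in> A \<union> B. h x = n} = {x \<in> A. h x = n} \<union> {x \<in> B. h x = n}" by auto
  thus "gen_fun w h (A \<union> B) $ n = (gen_fun w h A + gen_fun w h B) $ n"
    using assms by (simp add: gen_fun_nth finite_fibres_def) (subst sum.union_disjoint, auto)
qed

lemma gen_fun_add: "gen_fun w h A + gen_fun v h A = gen_fun (\<lambda>x. w x + v x) h A"
  by (rule fps_ext) (simp add: gen_fun_nth sum.distrib)

lemma gen_fun_uminus: "- gen_fun w h A = gen_fun (\<lambda>x. - w x) h A"
  by (rule fps_ext) (simp add: gen_fun_nth sum_negf)

lemma gen_fun_cmult: "fps_const c * gen_fun w h A = gen_fun (\<lambda>x. c * w x) h A"
  by (rule fps_ext) (simp add: gen_fun_nth sum_distrib_left)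

lemma gen_fun_X_power: "fps_X ^ m * gen_fun w h A = gen_fun w (\<lambda>x. m + h x) A"
proof (rule fps_ext)
  fix n
  have "{x \<in> A. m + h x = n} = (if n < m then {} else {x \<in> A. h x = n - m})" by auto
  thus "(fps_X ^ m * gen_fun w h A) $ n = gen_fun w (\<lambda>x. m + h x) A $ n"
    by (simp add: gen_fun_nth fps_X_power_mult_nth)
qed

lemma gen_fun_theta: "fps_X * fps_deriv (gen_fun w h A) = gen_fun (\<lambda>x. of_nat (h x) * w x) h A"
proof (rule fps_ext)
  fix n
  show "(fps_X * fps_deriv (gen_fun w h A)) $ n = gen_fun (\<lambda>x. of_nat (h x) * w x) h A $ n"
    by (cases n) (auto simp: gen_fun_nth sum_distrib_left intro!: sum.cong)
qed

lemma gen_fun_compose_X_power: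
  assumes "d > 0"
  shows "gen_fun w h A oo fps_X ^ d = gen_fun w (\<lambda>x. d * h x) A"
proof (rule fps_ext)
  fix n
  have "{x \<in> A. d * h x = n} = (if d dvd n then {x \<in> A. h x = n div d} else {})"
    using assms by auto
  thus "(gen_fun w h A oo fps_X ^ d) $ n = gen_fun w (\<lambda>x. d * h x) A $ n"
    using assms by (simp add: gen_fun_nth fps_nth_compose_X_power)
qed

section \<open>The Jacobi triple product\<close>

text \<open>The q-Pochhammer symbol (q; q)_n.\<close>

definition qfac :: "'a::comm_ring_1 \<Rightarrow> nat \<Rightarrow> 'a" where
  "qfac q n = (\<Prod>k\<in>{1..n}. (1 - q ^ k))"

lemma qfac_0 [simp]: "qfac q 0 = 1"
  by (simp add: qfac_def)

lemma qfac_Suc: "qfac q (Suc n) = qfac q n * (1 - q ^ Suc n)"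
  by (simp add: qfac_def)

text \<open>Gaussian binomials, given by a Pascal recurrence because a quotient of
  \<open>qfac\<close> values has no meaning in a general commutative ring. For k > n the truncated n
  - k is harmless, as it multiplies 0.\<close>

fun qbinom :: "'a::comm_ring_1 \<Rightarrow> nat \<Rightarrow> nat \<Rightarrow> 'a" where
  "qbinom q n 0 = 1"
| "qbinom q 0 (Suc k) = 0"
| "qbinom q (Suc n) (Suc k) = qbinom q n (Suc k) + q ^ (n - k) * qbinom q n k"

lemma qbinom_eq_0: "n < k \<Longrightarrow> qbinom q n k = 0"
  by (induction q n k rule: qbinom.induct) auto

lemma qbinom_self [simp]: "qbinom q n n = 1"
  by (induction n) (simp_all add: qbinom_eq_0)

lemma qbinom_qfac: "k \<le> n \<Longrightarrow> qbinom q n k * qfac q k * qfac q (n - k) = qfac q n"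
proof (induction n arbitrary: k)
  case (Suc n)
  show ?case
  proof (cases k)
    case k: (Suc l)
    show ?thesis
    proof (cases "l = n")
      case False
      hence "Suc l \<le> n" using Suc.prems k by simp
      then obtain d where d: "n = Suc l + d" using le_Suc_ex by blast
      have 1: "qbinom q n (Suc l) * qfac q (Suc l) * qfac q d = qfac q n"
        using Suc.IH[of "Suc l"] d by simp
      have 2: "qbinom q n l * qfac q l * qfac q (Suc d) = qfac q n"
        using Suc.IH[of l] d by simp
      have "qbinom q (Suc n) k * qfac q k * qfac q (Suc n - k) =
          qbinom q n (Suc l) * qfac q (Suc l) * qfac q d * (1 - q ^ Suc d) +
          q ^ Suc d * (1 - q ^ Suc l) * (qbinom q n l * qfac q l * qfac q (Suc d))"
        by (simp add: k d qfac_Suc algebra_simps)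
      also have "\<dots> = qfac q n * (1 - q ^ Suc d * q ^ Suc l)"
        unfolding 1 2 by (simp add: algebra_simps)
      also have "\<dots> = qfac q (Suc n)"
        by (simp add: qfac_Suc d power_add[symmetric] mult.commute del: power_Suc) (simp add: ac_simps)
      finally show ?thesis .
    qed (simp add: k qbinom_eq_0)
  qed simp
qed simp

text \<open>The last factor a + b q^N splits the sum in two, and the Pascal recurrence merges the
  parts because q^N = q^(N-k) q^k.\<close>

theorem q_binomial_theorem:
  fixes a b q :: "'a::comm_ring_1"
  shows "(\<Prod>i<N. (a + b * q ^ i)) =
    (\<Sum>k\<le>N. qbinom q N k * q ^ (k choose 2) * a ^ (N - k) * b ^ k)"
proof (induction N)
  case (Suc N)
  let ?t = "\<lambda>k. qbinom q N k * q ^ (k choose 2) * a ^ (N - k) * b ^ k"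
  have choose2: "(Suc k choose 2) = (k choose 2) + k" for k
    by (simp add: numeral_2_eq_2)
  have 1: "qbinom q (Suc N) (Suc k) * q ^ (Suc k choose 2) * a ^ (N - k) * b ^ Suc k =
      qbinom q N (Suc k) * q ^ (Suc k choose 2) * a ^ (N - k) * b ^ Suc k + b * q ^ N * ?t k"
    if "k \<le> N" for k
  proof -
    have "q ^ N = q ^ (N - k) * q ^ k" using that by (simp flip: power_add)
    thus ?thesis unfolding choose2 by (simp add: power_add algebra_simps)
  qed
  have 2: "a * ?t (Suc k) = qbinom q N (Suc k) * q ^ (Suc k choose 2) * a ^ (N - k) * b ^ Suc k"
    if "k \<le> N" for k
  proof (cases "k = N")
    case False
    hence "a ^ (N - k) = a * a ^ (N - Suc k)"
      using that by (metis Suc_diff_Suc le_neq_implies_less power_Suc)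
    thus ?thesis by (simp add: algebra_simps)
  qed (simp add: qbinom_eq_0)
  have "(\<Sum>k\<le>Suc N. qbinom q (Suc N) k * q ^ (k choose 2) * a ^ (Suc N - k) * b ^ k) =
      a ^ Suc N + (\<Sum>k\<le>N. qbinom q (Suc N) (Suc k) * q ^ (Suc k choose 2) * a ^ (N - k) * b ^ Suc k)"
    by (subst sum.atMost_Suc_shift) (simp add: numeral_2_eq_2)
  also have "\<dots> = a ^ Suc N + (\<Sum>k\<le>N. a * ?t (Suc k)) + b * q ^ N * (\<Sum>k\<le>N. ?t k)"
    unfolding add.assoc sum_distrib_left sum.distrib[symmetric] using 1 2 by simp
  also have "a ^ Suc N + (\<Sum>k\<le>N. a * ?t (Suc k)) = a * (\<Sum>k\<le>Suc N. ?t k)"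
    by (subst sum.atMost_Suc_shift) (simp add: numeral_2_eq_2 sum_distrib_left algebra_simps)
  also have "(\<Sum>k\<le>Suc N. ?t k) = (\<Sum>k\<le>N. ?t k)"
    by (simp add: qbinom_eq_0)
  finally show ?case unfolding prod.lessThan_Suc Suc.IH by (simp add: algebra_simps)
qed (simp add: numeral_2_eq_2)

text \<open>The exponent \<open>r j (j - 1) / 2 + \<beta> j\<close> of the theta series attached to the progressions
  \<open>\<plusminus>\<beta>\<close> modulo \<open>r\<close>.\<close>

definition jexp :: "nat \<Rightarrow> nat \<Rightarrow> int \<Rightarrow> nat" where
  "jexp r \<beta> j = nat (int r * (j * (j - 1) div 2) + int \<beta> * j)"

text \<open>The condition \<beta> \<le> r makes the exponent nonnegative for both signs of j, so the
  \<open>nat\<close> in \<open>jexp\<close> never truncates; doubling removes the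
  \<open>div 2\<close>.\<close>

lemma two_jexp:
  assumes "\<beta> \<le> r"
  shows "2 * int (jexp r \<beta> j) = int r * (j * (j - 1)) + 2 * int \<beta> * j"
proof -
  have 2: "2 * (j * (j - 1) div 2) = j * (j - 1)" by simp
  have "0 \<le> int r * (j * (j - 1)) + 2 * int \<beta> * j"
  proof (cases "j \<ge> 0")
    case True
    hence "j * (j - 1) \<ge> 0" by (cases "j = 0") auto
    thus ?thesis using True by simp
  next
    case False
    have "int \<beta> * (-j) \<le> int r * (-j)" using assms False by (intro mult_right_mono) auto
    moreover have "int r * 2 \<le> int r * (1 - j)" using False by (intro mult_left_mono) auto
    hence "int r * 2 * (-j) \<le> int r * (1 - j) * (-j)" using False by (intro mult_right_mono) auto
    ultimately show ?thesis by (simp add: algebra_simps)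
  qed
  hence "0 \<le> 2 * (int r * (j * (j - 1) div 2) + int \<beta> * j)"
    using 2 by (simp add: algebra_simps)
  hence "int (jexp r \<beta> j) = int r * (j * (j - 1) div 2) + int \<beta> * j"
    unfolding jexp_def by simp
  thus ?thesis using 2 by (simp add: algebra_simps)
qed

text \<open>Besides finiteness of fibres this serves \<open>agree_theta\<close>: there the term of
  index j is controlled to n - |j| + 1 places, and its exponent makes up the missing |j| -
  1.\<close>

lemma jexp_ge:
  assumes "\<beta> \<le> r" "r > 0"
  shows "\<bar>j\<bar> \<le> int (jexp r \<beta> j) + 1"
proof (cases "j \<ge> 0")
  case True
  have "j * (j - 1) \<ge> 0" using True by (cases "j = 0") auto
  hence "1 * (j * (j - 1)) \<le> int r * (j * (j - 1))" using assms by (intro mult_right_mono) auto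
  hence "2 * int (jexp r \<beta> j) \<ge> j * (j - 1)"
    using two_jexp[OF assms(1), of j] True by (simp add: add_increasing2)
  moreover have "(j - 1) * (j - 2) \<ge> 0"
    using True by (cases "j = 0 \<or> j = 1") (auto simp: mult_nonneg_nonneg)
  hence "j * (j - 1) \<ge> 2 * j - 2" by (simp add: algebra_simps)
  ultimately show ?thesis using True by linarith
next
  case False
  define i where "i = - j"
  have i: "i > 0" "j = - i" using False by (auto simp: i_def)
  define u where "u = i * (i - 1)"
  define v where "v = int r * i - int \<beta> * i"
  have "v \<ge> 0" unfolding v_def using assms i by (simp add: mult_right_mono)
  moreover have "1 * u \<le> int r * u"
    unfolding u_def using assms i by (intro mult_right_mono mult_nonneg_nonneg) auto
  moreover have "2 * int (jexp r \<beta> j) = int r * u + 2 * v"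
    using two_jexp[OF assms(1), of j] i by (simp add: u_def v_def algebra_simps)
  ultimately have "2 * int (jexp r \<beta> j) \<ge> i * (i - 1)" unfolding u_def by linarith
  moreover have "(i - 1) * (i - 2) \<ge> 0" using i by (cases "i = 1") auto
  hence "i * (i - 1) \<ge> 2 * i - 2" by (simp add: algebra_simps)
  ultimately show ?thesis using i by linarith
qed

lemma finite_fibres_jexp: "\<beta> \<le> r \<Longrightarrow> r > 0 \<Longrightarrow> finite_fibres (jexp r \<beta>) A"
  using jexp_ge by (intro finite_fibres_int[where c = 1]) auto

lemma two_choose_two: "2 * int (k choose 2) = int k * (int k - 1)"
proof -
  have "2 * (k choose 2) = k * (k - 1)" unfolding choose_two
    by (intro dvd_mult_div_cancel) (cases "even k", auto)
  thus ?thesis by (cases k) (auto simp flip: of_nat_mult of_nat_add simp: algebra_simps)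
qed

text \<open>All powers of \<open>x\<close> are kept nonnegative; the \<open>q\<close>-binomial theorem is applied with
  \<open>a = x ^ (r n - \<beta>)\<close> and a common power of \<open>x\<close> is cancelled.\<close>

theorem finite_jacobi_triple_product:
  fixes x b :: "'a::idom"
  assumes "x \<noteq> 0" "\<beta> \<le> r" "n > 0"
  shows "(\<Prod>i<n. (b + x ^ (r * (n - i) - \<beta>)) * (1 + b * x ^ (r * i + \<beta>))) =
    (\<Sum>k\<le>2 * n. qbinom (x ^ r) (2 * n) k * x ^ jexp r \<beta> (int k - int n) * b ^ k)"
proof -
  define a where "a = r * n - \<beta>"
  have rn: "\<beta> \<le> r * n" using assms(2,3) by (metis le_trans mult_le_mono2 mult.right_neutral Suc_leI One_nat_def)
  hence a: "int a = int r * int n - int \<beta>" by (simp add: a_def of_nat_diff)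
  \<comment> \<open>The power of x to be cancelled: the i-th of the first n factors releases x^(r
    i), each of the last n releases x^a.\<close>
  define D where "D = r * (n choose 2) + n * a"
  have split: "(\<Prod>i<n + m. f i) = (\<Prod>i<n. f i) * (\<Prod>i<m. f (n + i))" for m and f :: "nat \<Rightarrow> 'a"
    by (induction m) (simp_all add: mult.assoc)
  have low: "x ^ a + b * (x ^ r) ^ i = x ^ (r * i) * (b + x ^ (r * (n - i) - \<beta>))" if "i < n" for i
  proof -
    obtain d where d: "n = Suc (i + d)" using less_imp_Suc_add[OF \<open>i < n\<close>] by blast
    have "a = r * i + (r * (n - i) - \<beta>)"
      unfolding a_def d using assms(2) by (simp add: algebra_simps)
    hence "x ^ a = x ^ (r * i) * x ^ (r * (n - i) - \<beta>)" by (simp flip: power_add)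
    thus ?thesis by (simp add: algebra_simps flip: power_mult)
  qed
  have high: "x ^ a + b * (x ^ r) ^ (n + i) = x ^ a * (1 + b * x ^ (r * i + \<beta>))" for i
  proof -
    have "r * (n + i) = a + (r * i + \<beta>)" using rn by (simp add: a_def algebra_simps)
    hence "(x ^ r) ^ (n + i) = x ^ a * x ^ (r * i + \<beta>)" by (simp flip: power_mult power_add)
    thus ?thesis by (simp add: algebra_simps)
  qed
  have pows: "(\<Prod>i<n. x ^ (r * i)) = x ^ (r * (n choose 2))"
    by (induction n) (simp_all add: numeral_2_eq_2 power_add algebra_simps)
  have exps: "(x ^ r) ^ (k choose 2) * (x ^ a) ^ (2 * n - k) = x ^ D * x ^ jexp r \<beta> (int k - int n)"
    if "k \<le> 2 * n" for k
  proof -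
    have d: "int (2 * n - k) = 2 * int n - int k" using that by simp
    have "2 * int (r * (k choose 2) + a * (2 * n - k)) =
        int r * (2 * int (k choose 2)) + 2 * int a * (2 * int n - int k)"
      unfolding of_nat_add of_nat_mult d by (simp add: algebra_simps)
    also have "\<dots> = int r * (2 * int (n choose 2)) + 2 * int n * int a + 2 * int (jexp r \<beta> (int k - int n))"
      unfolding two_choose_two two_jexp[OF assms(2)] a by (simp add: algebra_simps)
    also have "\<dots> = 2 * int (D + jexp r \<beta> (int k - int n))"
      by (simp add: D_def algebra_simps)
    finally have "r * (k choose 2) + a * (2 * n - k) = D + jexp r \<beta> (int k - int n)"
      by (simp only: mult_cancel_left of_nat_eq_iff) simp
    thus ?thesis by (simp flip: power_mult power_add)
  qed
  have "x ^ D * (\<Prod>i<n. (b + x ^ (r * (n - i) - \<beta>)) * (1 + b * x ^ (r * i + \<beta>))) =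
      (\<Prod>i<n. x ^ (r * i) * (b + x ^ (r * (n - i) - \<beta>))) * (\<Prod>i<n. x ^ a * (1 + b * x ^ (r * i + \<beta>)))"
    unfolding prod.distrib pows D_def by (simp add: power_add power_mult mult_ac)
  also have "\<dots> = (\<Prod>i<n + n. (x ^ a + b * (x ^ r) ^ i))"
    unfolding split high using low by simp
  also have "\<dots> = (\<Sum>k\<le>2 * n. x ^ D *
      (qbinom (x ^ r) (2 * n) k * x ^ jexp r \<beta> (int k - int n) * b ^ k))"
    unfolding mult_2[symmetric] q_binomial_theorem
    by (intro sum.cong refl) (simp add: mult.assoc exps mult.left_commute)
  finally show ?thesis using assms(1) by (simp flip: sum_distrib_left)
qed

section \<open>Theta series as products\<close>

text \<open>Congruence modulo X^n. It replaces convergence: identities for infinite products are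
  proved modulo every X^n from finite ones.\<close>

definition agree :: "nat \<Rightarrow> 'a::comm_ring_1 fps \<Rightarrow> 'a fps \<Rightarrow> bool" where
  "agree n a b \<longleftrightarrow> (\<forall>k<n. a $ k = b $ k)"

lemma agree_refl [simp]: "agree n a a"
  by (simp add: agree_def)

lemma agree_sym: "agree n a b \<Longrightarrow> agree n b a"
  by (simp add: agree_def)

lemma agree_trans [trans]: "agree n a b \<Longrightarrow> agree n b c \<Longrightarrow> agree n a c"
  by (simp add: agree_def)

lemma agree_mono: "agree n a b \<Longrightarrow> m \<le> n \<Longrightarrow> agree m a b"
  by (simp add: agree_def)

lemma agree_mult: "agree n a b \<Longrightarrow> agree n c d \<Longrightarrow> agree n (a * c) (b * d)"
  by (simp add: agree_def fps_mult_nth)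

lemma agree_power: "agree n a b \<Longrightarrow> agree n (a ^ k) (b ^ k)"
  by (induction k) (simp_all add: agree_mult)

lemma agree_sum: "(\<And>i. i \<in> A \<Longrightarrow> agree n (f i) (h i)) \<Longrightarrow> agree n (sum f A) (sum h A)"
  by (simp add: agree_def fps_sum_nth)

lemma agree_X_power_mult: "agree n a b \<Longrightarrow> agree (n + m) (fps_X ^ m * a) (fps_X ^ m * b)"
  by (auto simp: agree_def fps_X_power_mult_nth)

lemma agree_compose_X_power:
  "agree n a b \<Longrightarrow> d > 0 \<Longrightarrow> agree n (a oo fps_X ^ d) (b oo fps_X ^ d)"
  unfolding agree_def fps_nth_compose_X_power by (auto simp: le_less_trans[OF div_le_dividend])

lemma agree_all_imp_eq: "(\<And>n. n > 0 \<Longrightarrow> agree n a b) \<Longrightarrow> a = b"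
  unfolding agree_def by (rule fps_ext) blast

section \<open>The Euler product in q^r and its finite truncations\<close>

definition euler_at :: "nat \<Rightarrow> rat fps" where
  "euler_at r = euler_fps oo fps_X ^ r"

lemma euler_at_1: "euler_at 1 = euler_fps"
  by (simp add: euler_at_def)

lemma euler_at_nth_0 [simp]: "euler_at r $ 0 = 1"
  by (simp add: euler_at_def euler_fps_def)

lemma euler_at_nonzero [simp]: "euler_at r \<noteq> 0"
  by (metis euler_at_nth_0 fps_zero_nth zero_neq_one)

lemma qfac_compose:
  "qfac (fps_X :: rat fps) n oo fps_X ^ r = qfac (fps_X ^ r) n" if "r > 0"
  using that unfolding qfac_def
  by (simp add: fps_compose_prod_distrib fps_compose_sub_distrib fps_compose_power[symmetric])

lemma agree_qfac:
  assumes "r > 0"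
  shows "agree (Suc n) (qfac (fps_X ^ r) n) (euler_at r)"
proof -
  have step: "qfac (fps_X :: rat fps) (k + m) $ k = qfac fps_X k $ k" for k m
  proof (induction m)
    case (Suc m)
    have "(qfac fps_X (k + m) * (1 - fps_X ^ Suc (k + m)) :: rat fps) $ k = qfac fps_X (k + m) $ k"
      by (simp add: right_diff_distrib fps_X_power_mult_right_nth del: power_Suc)
    thus ?case using Suc by (simp only: add_Suc_right qfac_Suc)
  qed simp
  have "qfac (fps_X :: rat fps) n $ k = euler_fps $ k" if "k < Suc n" for k
    using step[of k "n - k"] that by (simp add: euler_fps_def qfac_def)
  hence "agree (Suc n) (qfac fps_X n) euler_fps" by (simp add: agree_def)
  from agree_compose_X_power[OF this assms] show ?thesis
    by (simp add: qfac_compose assms euler_at_def)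
qed

text \<open>All three \<open>qfac\<close> factors in \<open>qbinom_qfac\<close> are close to the
  Euler product, so the Gaussian binomial tends to its inverse.\<close>

lemma agree_qbinom:
  assumes "r > 0" "k \<le> n" 
  shows "agree (Suc (min k (n - k))) (euler_at r * qbinom (fps_X ^ r) n k) 1"
proof -
  let ?m = "Suc (min k (n - k))"
  let ?q = "fps_X ^ r :: rat fps" and ?e = "euler_at r"
  have 1: "agree ?m (qfac ?q i) ?e" if "min k (n - k) \<le> i" for i
    using agree_mono[OF agree_qfac[OF assms(1)]] that by simp
  have "agree ?m (qbinom ?q n k * ?e * ?e) (qbinom ?q n k * qfac ?q k * qfac ?q (n - k))"
    by (intro agree_mult agree_refl agree_sym[OF 1]) auto
  also have "qbinom ?q n k * qfac ?q k * qfac ?q (n - k) = qfac ?q n"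
    by (rule qbinom_qfac) fact
  also have "agree ?m (qfac ?q n) ?e" using assms by (intro 1) auto
  finally have "agree ?m (qbinom ?q n k * ?e * ?e * inverse ?e) (?e * inverse ?e)"
    by (intro agree_mult) auto
  thus ?thesis by (simp add: inverse_mult_eq_1' mult.assoc) (simp add: mult.commute)
qed

text \<open>The binomials near k = 0 and k = 2n are far from their limit, but there the exponent is
  large enough to hide the error. Arbitrary coefficients c replace the powers of b, because Jacobi's
  cube needs weights that come from a derivative.\<close>

lemma agree_theta:
  fixes c :: "int \<Rightarrow> rat"
  assumes "\<beta> \<le> r" "r > 0"
  shows "agree n (euler_at r * (\<Sum>k\<le>2 * n. qbinom (fps_X ^ r) (2 * n) k *
      fps_X ^ jexp r \<beta> (int k - int n) * fps_const (c (int k - int n)))) (gen_fun c (jexp r \<beta>) UNIV)"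
proof -
  let ?h = "jexp r \<beta>"
  have "agree n (euler_at r * (qbinom (fps_X ^ r) (2 * n) k *
      fps_X ^ ?h (int k - int n) * fps_const (c (int k - int n))))
      (fps_X ^ ?h (int k - int n) * fps_const (c (int k - int n)))" if "k \<le> 2 * n" for k
  proof -
    let ?j = "int k - int n"
    have "int (min k (2 * n - k)) = int n - \<bar>?j\<bar>" using that by (simp add: min_def of_nat_diff)
    hence le: "n \<le> Suc (min k (2 * n - k)) + ?h ?j"
      using jexp_ge[OF assms, of ?j] by linarith
    have "agree n (fps_X ^ ?h ?j * (euler_at r * qbinom (fps_X ^ r) (2 * n) k)) (fps_X ^ ?h ?j * 1)"
      by (rule agree_mono[OF agree_X_power_mult[OF agree_qbinom] le]) (use assms that in auto)
    from agree_mult[OF this agree_refl[of n "fps_const (c ?j)"]]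
    show ?thesis by (simp add: mult_ac)
  qed
  hence "agree n (euler_at r * (\<Sum>k\<le>2 * n. qbinom (fps_X ^ r) (2 * n) k *
      fps_X ^ ?h (int k - int n) * fps_const (c (int k - int n))))
      (\<Sum>k\<le>2 * n. fps_X ^ ?h (int k - int n) * fps_const (c (int k - int n)))"
    unfolding sum_distrib_left by (intro agree_sum) auto
  also have "agree n \<dots> (gen_fun c ?h UNIV)"
    unfolding agree_def
  proof safe
    fix m assume m: "m < n"
    have "(\<Sum>k\<le>2 * n. fps_X ^ ?h (int k - int n) * fps_const (c (int k - int n))) $ m =
       (\<Sum>k\<le>2 * n. if ?h (int k - int n) = m then c (int k - int n) else 0)"
      by (auto simp: fps_sum_nth intro!: sum.cong)
    also have "\<dots> = (\<Sum>k\<in>{k. k \<le> 2 * n \<and> ?h (int k - int n) = m}. c (int k - int n))"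
      by (simp flip: sum.inter_filter)
    also have "\<dots> = (\<Sum>j | j \<in> UNIV \<and> ?h j = m. c j)"
    proof (rule sum.reindex_bij_betw)
      show "bij_betw (\<lambda>k. int k - int n) {k. k \<le> 2 * n \<and> ?h (int k - int n) = m}
          {j \<in> UNIV. ?h j = m}"
      proof (rule bij_betw_byWitness[where f' = "\<lambda>j. nat (j + int n)"])
        show "(\<lambda>j. nat (j + int n)) ` {j \<in> UNIV. ?h j = m}
            \<subseteq> {k. k \<le> 2 * n \<and> ?h (int k - int n) = m}"
        proof safe
          fix j assume "m = ?h j"
          hence "\<bar>j\<bar> \<le> int n" using jexp_ge[OF assms, of j] m by linarith
          thus "nat (j + int n) \<le> 2 * n" "?h (int (nat (j + int n)) - int n) = ?h j"
            by auto
        qed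
        show "\<forall>j\<in>{j \<in> UNIV. ?h j = m}. int (nat (j + int n)) - int n = j"
        proof safe
          fix j assume "m = ?h j"
          hence "\<bar>j\<bar> \<le> int n" using jexp_ge[OF assms, of j] m by linarith
          thus "int (nat (j + int n)) - int n = j" by auto
        qed
      qed auto
    qed
    finally show "(\<Sum>k\<le>2 * n. fps_X ^ ?h (int k - int n) * fps_const (c (int k - int n))) $ m =
        gen_fun c ?h UNIV $ m" by (simp add: gen_fun_nth)
  qed
  finally show ?thesis .
qed

text \<open>Passage to the limit: u n is the finite product, tending to b / a, and S is the theta
  series it yields after multiplication by the Euler product.\<close>

lemma agree_euler_mult_eq:
  assumes "\<And>n. n > 0 \<Longrightarrow> agree n (euler_at r * u n) S" "\<And>n. n > 0 \<Longrightarrow> agree n (u n * a) b"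
  shows "S * a = euler_at r * b"
proof (rule agree_all_imp_eq)
  fix n :: nat assume n: "n > 0"
  have "agree n (S * a) (euler_at r * u n * a)"
    by (intro agree_mult agree_refl agree_sym[OF assms(1)[OF n]])
  also have "euler_at r * u n * a = euler_at r * (u n * a)" by (simp add: mult_ac)
  also have "agree n \<dots> (euler_at r * b)" by (intro agree_mult agree_refl assms(2)[OF n])
  finally show "agree n (S * a) (euler_at r * b)" .
qed

lemma agree_qfac':
  assumes "r > 0" "n \<le> m"
  shows "agree n (qfac (fps_X ^ r) m) (euler_at r)"
  by (rule agree_mono[OF agree_qfac[OF assms(1)]]) (use assms in simp)

lemma qfac_odd_even:
  "(\<Prod>i<n. (1 - x ^ (2 * i + 1))) * qfac (x\<^sup>2) n = qfac x (2 * n)" for x :: "'a::comm_ring_1"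
proof (induction n)
  case (Suc n)
  have "(\<Prod>i<Suc n. (1 - x ^ (2 * i + 1))) * qfac (x\<^sup>2) (Suc n) =
      ((\<Prod>i<n. (1 - x ^ (2 * i + 1))) * qfac (x\<^sup>2) n) * (1 - x ^ Suc (2 * n)) * (1 - (x\<^sup>2) ^ Suc n)"
    by (simp add: qfac_Suc mult_ac del: power_Suc)
  also have "(x\<^sup>2) ^ Suc n = x ^ Suc (Suc (2 * n))" by (subst power_mult[symmetric]) simp
  finally show ?case unfolding Suc.IH by (simp add: qfac_Suc del: power_Suc)
qed simp

lemma qfac_plus:
  "(\<Prod>k\<in>{1..n}. (1 + x ^ k)) * qfac x n = qfac (x\<^sup>2) n" for x :: "'a::comm_ring_1"
proof -
  have "(\<Prod>k\<in>{1..n}. (1 + x ^ k)) * qfac x n = (\<Prod>k\<in>{1..n}. (1 + x ^ k) * (1 - x ^ k))"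
    unfolding qfac_def prod.distrib ..
  also have "\<dots> = qfac (x\<^sup>2) n"
    unfolding qfac_def
    by (intro prod.cong refl) (simp add: algebra_simps power_mult[symmetric] flip: power_add mult_2)
  finally show ?thesis .
qed

lemma qfac_plus_odd:
  "(\<Prod>i<n. (1 + x ^ (2 * i + 1))) * qfac x (2 * n) * qfac (x ^ 4) n = qfac (x\<^sup>2) n * qfac (x\<^sup>2) (2 * n)"
  for x :: "'a::comm_ring_1"
proof -
  have 1: "(1 + x ^ k) * (1 - x ^ k) = 1 - (x\<^sup>2) ^ k" for k
    by (simp add: algebra_simps power_mult[symmetric] flip: power_add mult_2)
  have "(\<Prod>i<n. (1 + x ^ (2 * i + 1))) * qfac x (2 * n) * qfac (x ^ 4) n =
      (\<Prod>i<n. (1 + x ^ (2 * i + 1)) * (1 - x ^ (2 * i + 1))) * qfac (x\<^sup>2) n * qfac ((x\<^sup>2)\<^sup>2) n"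
    unfolding qfac_odd_even[symmetric] prod.distrib by (simp add: mult_ac flip: power_mult)
  also have "\<dots> = qfac (x\<^sup>2) n * ((\<Prod>i<n. (1 - (x\<^sup>2) ^ (2 * i + 1))) * qfac ((x\<^sup>2)\<^sup>2) n)"
    unfolding 1 by (simp add: mult_ac)
  finally show ?thesis unfolding qfac_odd_even .
qed

section \<open>Three specialisations of the triple product\<close>

lemma jexp_2_1: "jexp 2 1 j = nat (j\<^sup>2)"
proof -
  have "2 * int (jexp 2 1 j) = 2 * j\<^sup>2"
    by (subst two_jexp) (simp_all add: power2_eq_square algebra_simps)
  thus ?thesis by simp
qed

definition alt :: "int \<Rightarrow> rat" where
  "alt j = (if even j then 1 else -1)"

lemma minus_one_power_alt: "(-1) ^ k = (-1) ^ n * fps_const (alt (int k - int n))"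
proof (cases "even n"; cases "even k")
qed (auto simp: alt_def simp flip: fps_const_neg)

text \<open>Take b = -1, r = 2, beta = 1: up to sign, the 2n factors are the 1 - q^(2i+1), each
  occurring twice.\<close>

theorem theta_minus: "gen_fun alt (jexp 2 1) UNIV * euler_at 2 = euler_fps\<^sup>2"
proof -
  define o_prod :: "nat \<Rightarrow> rat fps" where "o_prod = (\<lambda>n. \<Prod>i<n. (1 - fps_X ^ (2 * i + 1)))"
  have o_prod: "(\<Prod>i<n. (-1 + fps_X ^ (2 * (n - i) - 1)) * (1 + -1 * fps_X ^ (2 * i + 1))) =
      (-1) ^ n * (o_prod n)\<^sup>2" for n
  proof -
    have "(\<Prod>i<n. (-1 + fps_X ^ (2 * (n - i) - 1)) :: rat fps) = (\<Prod>i<n. (-1 + fps_X ^ (2 * (n - (n - Suc i)) - 1)))"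
      by (rule prod.nat_diff_reindex[symmetric])
    also have "\<dots> = (\<Prod>i<n. (-1) * (1 - fps_X ^ (2 * i + 1)))"
      by (intro prod.cong refl) (simp add: Suc_diff_Suc algebra_simps)
    also have "\<dots> = (-1) ^ n * o_prod n"
      unfolding prod.distrib o_prod_def by simp
    finally show ?thesis
      unfolding prod.distrib by (simp add: o_prod_def power2_eq_square mult_ac)
  qed
  have "gen_fun alt (jexp 2 1) UNIV * (euler_at 2)\<^sup>2 = euler_at 2 * euler_fps\<^sup>2"
  proof (rule agree_euler_mult_eq)
    fix n :: nat assume n: "n > 0"
    have "(-1) ^ n * (o_prod n)\<^sup>2 = (\<Sum>k\<le>2 * n. qbinom (fps_X ^ 2) (2 * n) k *
        fps_X ^ jexp 2 1 (int k - int n) * (-1) ^ k)"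
      unfolding o_prod[symmetric] by (rule finite_jacobi_triple_product) (use n in auto)
    also have "\<dots> = (\<Sum>k\<le>2 * n. (-1) ^ n * (qbinom (fps_X ^ 2) (2 * n) k *
        fps_X ^ jexp 2 1 (int k - int n) * fps_const (alt (int k - int n))))"
      by (intro sum.cong refl, subst minus_one_power_alt[of _ n], simp only: mult_ac)
    finally have "(-1) ^ n * (o_prod n)\<^sup>2 = (-1) ^ n * (\<Sum>k\<le>2 * n. qbinom (fps_X ^ 2) (2 * n) k *
        fps_X ^ jexp 2 1 (int k - int n) * fps_const (alt (int k - int n)))"
      unfolding sum_distrib_left .
    hence eq: "(o_prod n)\<^sup>2 = (\<Sum>k\<le>2 * n. qbinom (fps_X ^ 2) (2 * n) k *
        fps_X ^ jexp 2 1 (int k - int n) * fps_const (alt (int k - int n)))"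
      by (simp only: mult_cancel_left) simp
    show "agree n (euler_at 2 * (o_prod n)\<^sup>2) (gen_fun alt (jexp 2 1) UNIV)"
      unfolding eq by (rule agree_theta) auto
    have "agree n ((o_prod n * euler_at 2)\<^sup>2) ((o_prod n * qfac (fps_X\<^sup>2) n)\<^sup>2)"
      by (intro agree_power agree_mult agree_refl agree_sym[OF agree_qfac']) auto
    also have "o_prod n * qfac (fps_X\<^sup>2) n = qfac (fps_X ^ 1) (2 * n)"
      unfolding o_prod_def qfac_odd_even by simp
    also have "agree n ((qfac (fps_X ^ 1) (2 * n))\<^sup>2) ((euler_at 1)\<^sup>2)"
      by (intro agree_power agree_qfac') auto
    finally show "agree n ((o_prod n)\<^sup>2 * (euler_at 2)\<^sup>2) (euler_fps\<^sup>2)"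
      by (simp add: power_mult_distrib euler_at_1[unfolded One_nat_def])
  qed
  thus ?thesis by (simp add: power2_eq_square)
qed

text \<open>The same exponents with b = 1; \<open>qfac_plus_odd\<close> turns the factors 1 +
  q^(2i+1) into a quotient of Euler products.\<close>

theorem theta_plus: 
  "gen_fun (\<lambda>_. 1) (jexp 2 1) UNIV * (euler_fps\<^sup>2 * (euler_at 4)\<^sup>2) = euler_at 2 ^ 5"
proof -
  define p_prod :: "nat \<Rightarrow> rat fps" where "p_prod = (\<lambda>n. \<Prod>i<n. (1 + fps_X ^ (2 * i + 1)))"
  have p_prod: "(\<Prod>i<n. (1 + fps_X ^ (2 * (n - i) - 1)) * (1 + 1 * fps_X ^ (2 * i + 1))) = (p_prod n)\<^sup>2" for n
  proof -
    have "(\<Prod>i<n. (1 + fps_X ^ (2 * (n - i) - 1)) :: rat fps) = (\<Prod>i<n. (1 + fps_X ^ (2 * (n - (n - Suc i)) - 1)))"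
      by (rule prod.nat_diff_reindex[symmetric])
    also have "\<dots> = p_prod n"
      unfolding p_prod_def by (intro prod.cong refl) (simp add: Suc_diff_Suc)
    finally show ?thesis
      unfolding prod.distrib by (simp add: p_prod_def power2_eq_square mult_ac)
  qed
  have "gen_fun (\<lambda>_. 1) (jexp 2 1) UNIV * (euler_fps\<^sup>2 * (euler_at 4)\<^sup>2) = euler_at 2 * (euler_at 2 * euler_at 2)\<^sup>2"
  proof (rule agree_euler_mult_eq)
    fix n :: nat assume n: "n > 0"
    have eq: "(p_prod n)\<^sup>2 = (\<Sum>k\<le>2 * n. qbinom (fps_X ^ 2) (2 * n) k *
        fps_X ^ jexp 2 1 (int k - int n) * fps_const 1)"
      using finite_jacobi_triple_product[of "fps_X :: rat fps" 1 2 n 1] n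
      by (simp add: p_prod[simplified])
    show "agree n (euler_at 2 * (p_prod n)\<^sup>2) (gen_fun (\<lambda>_. 1) (jexp 2 1) UNIV)"
      unfolding eq by (rule agree_theta) auto
    have "agree n ((p_prod n * euler_at 1 * euler_at 4)\<^sup>2)
        ((p_prod n * qfac (fps_X ^ 1) (2 * n) * qfac (fps_X ^ 4) n)\<^sup>2)"
      by (intro agree_power agree_mult agree_refl agree_sym[OF agree_qfac']) auto
    also have "p_prod n * qfac (fps_X ^ 1) (2 * n) * qfac (fps_X ^ 4) n =
        qfac (fps_X\<^sup>2) n * qfac (fps_X\<^sup>2) (2 * n)"
      unfolding p_prod_def power_one_right qfac_plus_odd ..
    also have "agree n ((qfac (fps_X\<^sup>2) n * qfac (fps_X\<^sup>2) (2 * n))\<^sup>2) ((euler_at 2 * euler_at 2)\<^sup>2)"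
      by (intro agree_power agree_mult agree_qfac') auto
    finally show "agree n ((p_prod n)\<^sup>2 * (euler_fps\<^sup>2 * (euler_at 4)\<^sup>2)) ((euler_at 2 * euler_at 2)\<^sup>2)"
      by (simp add: power_mult_distrib euler_at_1[unfolded One_nat_def] mult_ac)
  qed
  also have "\<dots> = euler_at 2 ^ 5" by Groebner_Basis.algebra
  finally show ?thesis .
qed

text \<open>Here b = 1, r = 1, beta = 0. Each triangular number arises from both j and 1 - j, hence
  the 2; on the product side it is the factor 1 + q^0.\<close>

theorem theta_triangular:
  "gen_fun (\<lambda>_. 1) (jexp 1 0) UNIV * euler_fps = 2 * (euler_at 2)\<^sup>2"
proof -
  define Q :: "nat \<Rightarrow> rat fps" where "Q = (\<lambda>n. \<Prod>k\<in>{1..n}. (1 + fps_X ^ k))"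
  define R :: "nat \<Rightarrow> rat fps" where "R = (\<lambda>n. \<Prod>i<n. (1 + fps_X ^ i))"
  have R: "R n * (1 + fps_X ^ n) = 2 * Q n" for n
  proof (induction n)
    case (Suc n)
    have "R (Suc n) * (1 + fps_X ^ Suc n) = R n * (1 + fps_X ^ n) * (1 + fps_X ^ Suc n)"
      by (simp add: R_def)
    also have "\<dots> = 2 * (Q n * (1 + fps_X ^ Suc n))" unfolding Suc.IH by (simp only: mult.assoc)
    also have "Q n * (1 + fps_X ^ Suc n) = Q (Suc n)" by (simp add: Q_def)
    finally show ?case .
  qed (simp add: Q_def R_def)
  have Q: "(\<Prod>i<n. (1 + fps_X ^ (n - i))) = Q n" for n
  proof -
    have "(\<Prod>i<n. (1 + fps_X ^ (n - i)) :: rat fps) = (\<Prod>i<n. (1 + fps_X ^ (n - (n - Suc i))))"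
      by (rule prod.nat_diff_reindex[symmetric])
    also have "\<dots> = (\<Prod>i<n. (1 + fps_X ^ Suc i))"
      by (intro prod.cong refl) (simp add: Suc_diff_Suc)
    also have "\<dots> = Q n" unfolding Q_def by (simp add: prod.atLeast1_atMost_eq)
    finally show ?thesis .
  qed
  have "gen_fun (\<lambda>_. 1) (jexp 1 0) UNIV * (euler_fps\<^sup>2) = euler_at 1 * (2 * (euler_at 2)\<^sup>2)"
  proof (rule agree_euler_mult_eq)
    fix n :: nat assume n: "n > 0"
    have eq: "R n * Q n = (\<Sum>k\<le>2 * n. qbinom (fps_X ^ 1) (2 * n) k *
        fps_X ^ jexp 1 0 (int k - int n) * fps_const 1)"
      using finite_jacobi_triple_product[of "fps_X :: rat fps" 0 1 n 1] n
      by (simp add: prod.distrib Q R_def mult_ac)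
    show "agree n (euler_at 1 * (R n * Q n)) (gen_fun (\<lambda>_. 1) (jexp 1 0) UNIV)"
      unfolding eq by (rule agree_theta) auto
    have "agree n (R n * 1 * Q n * (euler_at 1)\<^sup>2) (R n * (1 + fps_X ^ n) * Q n * (qfac (fps_X ^ 1) n)\<^sup>2)"
      by (intro agree_mult agree_power agree_refl agree_sym[OF agree_qfac']) (auto simp: agree_def)
    also have "\<dots> = 2 * (Q n * qfac fps_X n)\<^sup>2"
      unfolding R by (simp add: power2_eq_square mult_ac)
    also have "Q n * qfac fps_X n = qfac (fps_X\<^sup>2) n" unfolding Q_def by (rule qfac_plus)
    also have "agree n (2 * (qfac (fps_X\<^sup>2) n)\<^sup>2) (2 * (euler_at 2)\<^sup>2)"
      by (intro agree_mult agree_power agree_refl agree_qfac') auto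
    finally show "agree n (R n * Q n * euler_fps\<^sup>2) (2 * (euler_at 2)\<^sup>2)"
      by (simp add: euler_at_1[unfolded One_nat_def])
  qed
  hence "euler_fps * (gen_fun (\<lambda>_. 1) (jexp 1 0) UNIV * euler_fps) = euler_fps * (2 * (euler_at 2)\<^sup>2)"
    by (simp only: euler_at_1 power2_eq_square mult_ac)
  thus ?thesis using euler_at_nonzero[of 1] by (simp only: mult_cancel_left euler_at_1) simp
qed

section \<open>Jacobi's identity for the cube of the Euler product\<close>

text \<open>Lets the triple product be read with b an indeterminate over power series, as
  differentiation in b requires.\<close>

lemma qbinom_pCons: "qbinom [:q:] n k = [:qbinom q n k:]"
  by (induction q n k rule: qbinom.induct) (simp_all add: poly_const_pow)

lemma jexp_1_0_reflect: "jexp 1 0 (1 - j) = jexp 1 0 j"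
proof -
  have "(1 - j) * (1 - j - 1) = j * (j - 1)" by (simp add: algebra_simps)
  thus ?thesis by (simp only: jexp_def)
qed

text \<open>The reflection j to 1 - j keeps the exponent and flips the sign.\<close>

lemma gen_fun_alt_jexp_1_0: "gen_fun alt (jexp 1 0) UNIV = 0"
proof -
  have "gen_fun alt (jexp 1 0) UNIV = gen_fun (\<lambda>j. - alt j) (jexp 1 0) UNIV"
    by (rule gen_fun_reindex[where f = "\<lambda>j. 1 - j"])
       (auto intro!: bij_betwI[where g = "\<lambda>j. 1 - j"] simp: alt_def jexp_1_0_reflect[unfolded One_nat_def])
  also have "\<dots> = - gen_fun alt (jexp 1 0) UNIV" by (simp add: gen_fun_uminus)
  finally show ?thesis by (metis add_self_div_2 div_0 eq_neg_iff_add_eq_0 mult_2 mult_eq_0_iff zero_neq_numeral)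
qed

text \<open>The weights come from differentiating the finite triple product with respect to \<open>b\<close>
  at \<open>b = -1\<close>, where the factor \<open>1 + b\<close> vanishes.\<close>

lemma gen_fun_jexp_cube: "gen_fun (\<lambda>j. - alt j * of_int j) (jexp 1 0) UNIV = euler_fps ^ 3"
proof (rule agree_all_imp_eq)
  fix n :: nat assume "n > 0"
  then obtain m where n: "n = Suc m" by (cases n) auto
  define b x :: "rat fps poly" where "b = [:0, 1:]" and "x = [:fps_X:]"
  define A B where "A = (\<Prod>i<n. (b + x ^ (n - i)))" and "B = (\<Prod>i<m. (1 + b * x ^ Suc i))"
  define Q where "Q = (\<lambda>k. qbinom (fps_X ^ 1) (2 * n) k * fps_X ^ jexp 1 0 (int k - int n) :: rat fps)"
  have "A * ((1 + b) * B) = (\<Prod>i<n. (b + x ^ (1 * (n - i) - 0)) * (1 + b * x ^ (1 * i + 0)))"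
    unfolding prod.distrib A_def B_def n by (subst (2) prod.lessThan_Suc_shift) simp
  also have "\<dots> = (\<Sum>k\<le>2 * n. qbinom (x ^ 1) (2 * n) k * x ^ jexp 1 0 (int k - int n) * b ^ k)"
    by (rule finite_jacobi_triple_product) (simp_all add: x_def n)
  also have "\<dots> = (\<Sum>k\<le>2 * n. Polynomial.monom (Q k) k)"
    by (intro sum.cong refl)
       (simp add: x_def b_def Q_def qbinom_pCons poly_const_pow monom_altdef mult.commute)
  finally have "poly (pderiv (A * ((1 + b) * B))) (-1) = poly (pderiv (\<Sum>k\<le>2 * n. Polynomial.monom (Q k) k)) (-1)"
    by simp
  moreover have "poly (pderiv (A * ((1 + b) * B))) (-1) = poly A (-1) * poly B (-1)"
    by (simp add: pderiv_mult pderiv_add b_def pderiv_pCons)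
  moreover have "poly A (-1) = (-1) ^ n * qfac fps_X n"
  proof -
    have "poly A (-1) = (\<Prod>i<n. (-1 + fps_X ^ (n - i)))"
      by (simp add: A_def poly_prod b_def x_def poly_const_pow)
    also have "\<dots> = (\<Prod>i<n. (-1 + fps_X ^ (n - (n - Suc i))))"
      by (rule prod.nat_diff_reindex[symmetric])
    also have "\<dots> = (\<Prod>i<n. (-1) * (1 - fps_X ^ Suc i))"
      by (intro prod.cong refl) (simp add: Suc_diff_Suc algebra_simps)
    also have "\<dots> = (-1) ^ n * qfac fps_X n"
      unfolding prod.distrib qfac_def by (simp add: prod.atLeast1_atMost_eq)
    finally show ?thesis .
  qed
  moreover have "poly B (-1) = qfac fps_X m"
    by (simp add: B_def poly_prod b_def x_def poly_const_pow qfac_def prod.atLeast1_atMost_eq 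
        flip: power_Suc)
  moreover have "poly (pderiv (\<Sum>k\<le>2 * n. Polynomial.monom (Q k) k)) (-1) = (\<Sum>k\<le>2 * n. of_nat k * Q k * (-1) ^ (k - 1))"
    by (simp add: higher_pderiv_sum[of 1, simplified] poly_sum pderiv_monom poly_monom)
  ultimately have "(-1) ^ n * (qfac fps_X n * qfac fps_X m) = (\<Sum>k\<le>2 * n. of_nat k * Q k * (-1) ^ (k - 1))"
    by (simp add: mult.assoc)
  \<comment> \<open>Write k = j + n; the constant n contributes a multiple of the series that
    vanishes by \<open>gen_fun_alt_jexp_1_0\<close>. At k = 0 the truncated k - 1 is multiplied by
    0.\<close>
  also have "\<dots> = (\<Sum>k\<le>2 * n. (-1) ^ n *
      (Q k * fps_const ((of_int (int k - int n) + of_nat n) * - alt (int k - int n))))"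
  proof (intro sum.cong refl)
    fix k
    show "of_nat k * Q k * (-1) ^ (k - 1) =
      (-1) ^ n * (Q k * fps_const ((of_int (int k - int n) + of_nat n) * - alt (int k - int n)))"
    proof (cases k)
      case (Suc l)
      have "(-1) ^ (k - 1) = - ((-1) ^ k :: rat fps)" by (simp add: Suc)
      also have "\<dots> = (-1) ^ n * fps_const (- alt (int k - int n))"
        by (subst minus_one_power_alt[of k n]) (simp flip: fps_const_neg)
      finally show ?thesis
        by (simp add: mult_ac fps_of_nat[symmetric] flip: fps_const_mult)
    qed simp
  qed
  finally have "(-1) ^ n * (qfac fps_X n * qfac fps_X m) = (-1) ^ n *
      (\<Sum>k\<le>2 * n. Q k * fps_const ((of_int (int k - int n) + of_nat n) * - alt (int k - int n)))"
    unfolding sum_distrib_left .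
  hence eq: "qfac fps_X n * qfac fps_X m =
      (\<Sum>k\<le>2 * n. Q k * fps_const ((of_int (int k - int n) + of_nat n) * - alt (int k - int n)))"
    by (simp only: mult_cancel_left) simp
  have "agree n (gen_fun (\<lambda>j. (of_int j + of_nat n) * - alt j) (jexp 1 0) UNIV) (euler_at 1 * (qfac fps_X n * qfac fps_X m))"
    unfolding eq Q_def by (rule agree_sym[OF agree_theta]) auto
  also have "agree n \<dots> (euler_at 1 * (euler_at 1 * euler_at 1))"
    using agree_qfac[of 1 n] agree_qfac[of 1 m]
    by (intro agree_mult agree_refl) (auto simp: n intro: agree_mono)
  also have "\<dots> = euler_fps ^ 3" by (simp only: euler_at_1 power3_eq_cube mult.assoc)
  also have "gen_fun (\<lambda>j. (of_int j + of_nat n) * - alt j) (jexp 1 0) UNIV =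
      gen_fun (\<lambda>j. - alt j * of_int j) (jexp 1 0) UNIV + fps_const (- of_nat n) * gen_fun alt (jexp 1 0) UNIV"
    unfolding gen_fun_cmult gen_fun_add by (simp add: algebra_simps)
  finally show "agree n (gen_fun (\<lambda>j. - alt j * of_int j) (jexp 1 0) UNIV) (euler_fps ^ 3)"
    unfolding gen_fun_alt_jexp_1_0 by simp
qed

text \<open>The usual sum of (-1)^n (2n+1) q^(n(n+1)/2): choosing c = 1 (mod 4) among 2n+1 and
  -(2n+1) absorbs the sign. Folding the even j onto the odd ones by j to 1 - j adds the weights j
  and j - 1 to c = 2j - 1.\<close>

theorem jacobi_cube:
  "gen_fun of_int (\<lambda>c. nat ((c\<^sup>2 - 1) div 8)) {c. c mod 4 = 1} = euler_fps ^ 3"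
proof -
  let ?h = "jexp 1 0" and ?w = "\<lambda>j. - alt j * of_int j"
  have fin: "finite_fibres ?h S" for S by (rule finite_fibres_jexp) auto
  have "euler_fps ^ 3 = gen_fun ?w ?h ({j. odd j} \<union> {j. even j})"
    unfolding gen_fun_jexp_cube[symmetric] by (rule arg_cong[where f = "gen_fun ?w ?h"]) auto
  also have "\<dots> = gen_fun ?w ?h {j. odd j} + gen_fun ?w ?h {j. even j}"
    by (rule gen_fun_Un[OF fin fin]) auto
  also have "gen_fun ?w ?h {j. even j} = gen_fun (\<lambda>j. of_int (j - 1)) ?h {j. odd j}"
    by (rule gen_fun_reindex[where f = "\<lambda>j. 1 - j"])
       (auto intro!: bij_betwI[where g = "\<lambda>j. 1 - j"] simp: alt_def jexp_1_0_reflect[unfolded One_nat_def])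
  also have "gen_fun ?w ?h {j. odd j} = gen_fun of_int ?h {j. odd j}"
    by (rule gen_fun_reindex[where f = id]) (auto simp: alt_def)
  also have "gen_fun of_int ?h {j. odd j} + gen_fun (\<lambda>j. of_int (j - 1)) ?h {j. odd j} =
      gen_fun (\<lambda>j. of_int (2 * j - 1)) ?h {j. odd j}"
    unfolding gen_fun_add by (simp add: algebra_simps)
  also have "\<dots> = gen_fun of_int (\<lambda>c. nat ((c\<^sup>2 - 1) div 8)) {c. c mod 4 = 1}"
  proof (rule gen_fun_reindex[where f = "\<lambda>j. 2 * j - 1"])
    show "bij_betw (\<lambda>j. 2 * j - 1) {j. odd j} {c::int. c mod 4 = 1}"
      by (rule bij_betwI[where g = "\<lambda>c. (c + 1) div 2"]) (auto, presburger+)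
  next
    fix j :: int
    have "(2 * j - 1)\<^sup>2 - 1 = 4 * (j * (j - 1))" by (simp add: power2_eq_square algebra_simps)
    hence "((2 * j - 1)\<^sup>2 - 1) div 8 = j * (j - 1) div 2" by simp
    thus "jexp 1 0 j = nat (((2 * j - 1)\<^sup>2 - 1) div 8)" by (simp add: jexp_def)
  qed simp_all
  finally show ?thesis ..
qed

section \<open>The modular parametrisation\<close>

lemma euler_at_compose: "r > 0 \<Longrightarrow> d > 0 \<Longrightarrow> euler_at r oo fps_X ^ d = euler_at (r * d)"
  unfolding euler_at_def
  by (subst fps_compose_assoc[symmetric])
     (simp_all add: fps_X_power_compose power_mult[symmetric] mult.commute)

lemma euler_fps_compose: "euler_fps oo fps_X ^ d = euler_at d"
  by (simp add: euler_at_def)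

lemma compose_X_power_mult: "d > 0 \<Longrightarrow> a * b oo fps_X ^ d = (a oo fps_X ^ d) * (b oo fps_X ^ d)"
  for a b :: "rat fps"
  by (rule fps_compose_mult_distrib) simp

lemma compose_X_power_power: "d > 0 \<Longrightarrow> a ^ n oo fps_X ^ d = (a oo fps_X ^ d) ^ n"
  for a :: "rat fps"
  by (simp add: fps_compose_power)

lemma finite_fibres_square: "c > 0 \<Longrightarrow> finite_fibres (\<lambda>x. nat (c * x\<^sup>2)) A"
proof (rule finite_fibres_int[where c = 0])
  fix x :: int assume c: "c > 0"
  have "\<bar>x\<bar> \<le> \<bar>x\<bar> * \<bar>x\<bar>"
    using mult_left_mono[of 1 "\<bar>x\<bar>" "\<bar>x\<bar>"] by (cases "x = 0") auto
  also have "\<dots> = 1 * x\<^sup>2" by (simp add: power2_eq_square)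
  also have "\<dots> \<le> c * x\<^sup>2" using c by (intro mult_right_mono) auto
  finally show "\<bar>x\<bar> \<le> int (nat (c * x\<^sup>2)) + 0" using c by (simp add: less_imp_le)
qed

lemma finite_fibres_square1: "finite_fibres (\<lambda>x. nat (x\<^sup>2)) A" for A :: "int set"
  using finite_fibres_square[of 1 A] by simp

text \<open>As eta quotients, by the product lemmas below, the five series are eta(8z)^3,
  eta(4z)^2/eta(8z), eta(8z)^5/(eta(4z)^2 eta(16z)^2), eta(16z)^5/(eta(8z)^2 eta(32z)^2) and 2
  eta(32z)^2/eta(16z). The first two multiply to g; the last three give the curve on which s
  lives.\<close>

definition theta_odd_weighted :: "rat fps" where "theta_odd_weighted = gen_fun of_int (\<lambda>c. nat (c\<^sup>2)) {c. c mod 4 = 1}"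
definition theta_even_alt :: "rat fps" where "theta_even_alt = gen_fun (\<lambda>b. alt (b div 2)) (\<lambda>b. nat (b\<^sup>2)) {b. even b}"
definition theta_even :: "rat fps" where "theta_even = gen_fun (\<lambda>_. 1) (\<lambda>b. nat (b\<^sup>2)) {b. even b}"
definition theta_even2 :: "rat fps" where "theta_even2 = gen_fun (\<lambda>_. 1) (\<lambda>b. nat (2 * b\<^sup>2)) {b. even b}"
definition theta_odd2 :: "rat fps" where "theta_odd2 = gen_fun (\<lambda>_. 1) (\<lambda>a. nat (2 * a\<^sup>2)) {a. odd a}"

lemma theta_odd_weighted_product: "theta_odd_weighted = fps_X * euler_at 8 ^ 3"
proof -
  have "euler_at 8 ^ 3 = euler_fps ^ 3 oo fps_X ^ 8"
    by (simp add: compose_X_power_power euler_fps_compose)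
  also have "\<dots> = gen_fun of_int (\<lambda>c. 8 * nat ((c\<^sup>2 - 1) div 8)) {c. c mod 4 = 1}"
    unfolding jacobi_cube[symmetric] by (rule gen_fun_compose_X_power) simp
  finally have "fps_X ^ 1 * euler_at 8 ^ 3 = gen_fun of_int (\<lambda>c. 1 + 8 * nat ((c\<^sup>2 - 1) div 8)) {c. c mod 4 = 1}"
    by (simp only: gen_fun_X_power)
  also have "\<dots> = theta_odd_weighted"
    unfolding theta_odd_weighted_def
  proof (rule gen_fun_reindex[where f = id])
    fix c :: int assume "c \<in> {c. c mod 4 = 1}"
    then obtain d where d: "c = 4 * d + 1" by (metis mem_Collect_eq mult_div_mod_eq)
    have "c\<^sup>2 - 1 = 8 * (d * (2 * d + 1))" by (simp add: d power2_eq_square algebra_simps)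
    hence "8 * ((c\<^sup>2 - 1) div 8) = c\<^sup>2 - 1" by simp
    moreover have "c\<^sup>2 \<ge> 1" using d by (auto simp: power2_eq_square) (smt (verit) d mult_eq_0_iff not_square_less_zero zero_less_mult_iff)
    ultimately show "1 + 8 * nat ((c\<^sup>2 - 1) div 8) = nat ((id c)\<^sup>2)" by simp
  qed auto
  finally show ?thesis by simp
qed

lemma bij_double: "bij_betw (\<lambda>j. 2 * j) UNIV {b::int. even b}"
  by (rule bij_betwI[where g = "\<lambda>b. b div 2"]) auto

lemma theta_even_alt_product: "theta_even_alt * euler_at 8 = (euler_at 4)\<^sup>2"
proof -
  have "gen_fun alt (jexp 2 1) UNIV oo fps_X ^ 4 = gen_fun alt (\<lambda>j. 4 * jexp 2 1 j) UNIV"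
    by (rule gen_fun_compose_X_power) simp
  also have "\<dots> = theta_even_alt"
    unfolding theta_even_alt_def jexp_2_1
    by (rule gen_fun_reindex[OF bij_double]) (auto simp: power_mult_distrib nat_mult_distrib)
  finally have 1: "gen_fun alt (jexp 2 1) UNIV oo fps_X ^ 4 = theta_even_alt" .
  have "(gen_fun alt (jexp 2 1) UNIV * euler_at 2) oo fps_X ^ 4 = euler_fps\<^sup>2 oo fps_X ^ 4"
    by (simp only: theta_minus)
  thus ?thesis
    by (simp add: compose_X_power_mult 1[unfolded One_nat_def] compose_X_power_power euler_fps_compose euler_at_compose)
qed

lemma theta_plus_at:
  assumes "d > 0" "\<And>j. d * nat (j\<^sup>2) = h (2 * j)"
  shows "gen_fun (\<lambda>_. 1) h {b. even b} * ((euler_at d)\<^sup>2 * (euler_at (4 * d))\<^sup>2) = euler_at (2 * d) ^ 5"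
proof -
  have "gen_fun (\<lambda>_. 1) (jexp 2 1) UNIV oo fps_X ^ d = gen_fun (\<lambda>_. 1 :: rat) (\<lambda>j. d * jexp 2 1 j) UNIV"
    by (rule gen_fun_compose_X_power) fact
  also have "\<dots> = gen_fun (\<lambda>_. 1) h {b. even b}"
    unfolding jexp_2_1 by (rule gen_fun_reindex[OF bij_double]) (auto simp: assms)
  finally have 1: "gen_fun (\<lambda>_. 1 :: rat) (jexp 2 1) UNIV oo fps_X ^ d = gen_fun (\<lambda>_. 1) h {b. even b}" .
  have "(gen_fun (\<lambda>_. 1) (jexp 2 1) UNIV * (euler_fps\<^sup>2 * (euler_at 4)\<^sup>2)) oo fps_X ^ d = euler_at 2 ^ 5 oo fps_X ^ d"
    by (simp only: theta_plus)
  thus ?thesis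
    using assms(1) by (simp add: compose_X_power_mult 1[unfolded One_nat_def] compose_X_power_power euler_fps_compose euler_at_compose)
qed

lemma theta_even_product: "theta_even * ((euler_at 4)\<^sup>2 * (euler_at 16)\<^sup>2) = euler_at 8 ^ 5"
  using theta_plus_at[of 4 "\<lambda>b. nat (b\<^sup>2)"]
  by (simp add: theta_even_def power_mult_distrib nat_mult_distrib)

lemma theta_even2_product: "theta_even2 * ((euler_at 8)\<^sup>2 * (euler_at 32)\<^sup>2) = euler_at 16 ^ 5"
  using theta_plus_at[of 8 "\<lambda>b. nat (2 * b\<^sup>2)"]
  by (simp add: theta_even2_def power_mult_distrib nat_mult_distrib)

lemma theta_odd2_product: "theta_odd2 * euler_at 16 = 2 * fps_X\<^sup>2 * (euler_at 32)\<^sup>2"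
proof -
  have "gen_fun (\<lambda>_. 1) (jexp 1 0) UNIV oo fps_X ^ 16 = gen_fun (\<lambda>_. 1 :: rat) (\<lambda>j. 16 * jexp 1 0 j) UNIV"
    by (rule gen_fun_compose_X_power) simp
  hence "fps_X\<^sup>2 * (gen_fun (\<lambda>_. 1) (jexp 1 0) UNIV oo fps_X ^ 16) = gen_fun (\<lambda>_. 1 :: rat) (\<lambda>j. 2 + 16 * jexp 1 0 j) UNIV"
    by (simp only: gen_fun_X_power)
  also have "\<dots> = theta_odd2"
    unfolding theta_odd2_def
  proof (rule gen_fun_reindex[where f = "\<lambda>j. 2 * j - 1"])
    show "bij_betw (\<lambda>j. 2 * j - 1) UNIV {a::int. odd a}"
      by (rule bij_betwI[where g = "\<lambda>c. (c + 1) div 2"]) (auto elim!: oddE)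
  next
    fix j :: int
    have "int (2 + 16 * jexp 1 0 j) = 2 + 8 * (2 * int (jexp 1 0 j))" by simp
    also have "\<dots> = 2 * (2 * j - 1)\<^sup>2"
      by (subst two_jexp) (simp_all add: power2_eq_square algebra_simps)
    finally show "2 + 16 * jexp 1 0 j = nat (2 * (2 * j - 1)\<^sup>2)" by linarith
  qed simp_all
  finally have 1: "fps_X\<^sup>2 * (gen_fun (\<lambda>_. 1) (jexp 1 0) UNIV oo fps_X ^ 16) = theta_odd2" .
  have "(gen_fun (\<lambda>_. 1) (jexp 1 0) UNIV * euler_fps) oo fps_X ^ 16 = (2 * (euler_at 2)\<^sup>2) oo fps_X ^ 16"
    by (simp only: theta_triangular)
  hence "fps_X\<^sup>2 * (gen_fun (\<lambda>_. 1) (jexp 1 0) UNIV oo fps_X ^ 16) * euler_at 16 = fps_X\<^sup>2 * (2 * (euler_at 32)\<^sup>2)"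
    by (simp add: compose_X_power_mult compose_X_power_power euler_fps_compose euler_at_compose)
  thus ?thesis unfolding 1 by (simp add: mult_ac)
qed

text \<open>The next two identities come from rotating the lattice: \<open>(a, b) \<mapsto> (a + b, a - b)\<close>.\<close>

lemma theta_even2_thN_thC: "theta_even2\<^sup>2 + theta_odd2\<^sup>2 = theta_even\<^sup>2"
proof -
  let ?h2 = "\<lambda>z. nat (2 * (fst z)\<^sup>2) + nat (2 * (snd z)\<^sup>2)"
  let ?S = "({b::int. even b} \<times> {b::int. even b}) \<union> ({a. odd a} \<times> {a. odd a})"
  have fin: "finite_fibres ?h2 (A \<times> B)" for A B by (intro finite_fibres_Times finite_fibres_square) auto
  have "theta_even2\<^sup>2 + theta_odd2\<^sup>2 = gen_fun (\<lambda>z. 1) ?h2 ({b. even b} \<times> {b. even b}) + gen_fun (\<lambda>z. 1) ?h2 ({a. odd a} \<times> {a. odd a})"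
    unfolding power2_eq_square[of theta_even2] power2_eq_square[of theta_odd2] unfolding theta_even2_def theta_odd2_def
    by (subst (1 2) gen_fun_mult) (auto intro!: finite_fibres_square finite_fibres_square1)
  also have "\<dots> = gen_fun (\<lambda>z. 1) ?h2 ?S"
    by (rule gen_fun_Un[OF fin fin, symmetric]) auto
  also have "\<dots> = gen_fun (\<lambda>z. 1) (\<lambda>z. nat ((fst z)\<^sup>2) + nat ((snd z)\<^sup>2)) ({b. even b} \<times> {b. even b})"
  proof (rule gen_fun_reindex[where f = "\<lambda>z. (fst z + snd z, fst z - snd z)"])
    show "bij_betw (\<lambda>z. (fst z + snd z, fst z - snd z)) ?S ({b. even b} \<times> {b. even b})"
      by (rule bij_betwI[where g = "\<lambda>z. ((fst z + snd z) div 2, (fst z - snd z) div 2)"])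
         auto
  next
    fix z :: "int \<times> int"
    have "2 * (fst z)\<^sup>2 + 2 * (snd z)\<^sup>2 = (fst z + snd z)\<^sup>2 + (fst z - snd z)\<^sup>2"
      by (simp add: power2_eq_square algebra_simps)
    thus "?h2 z = nat ((fst (fst z + snd z, fst z - snd z))\<^sup>2) +
        nat ((snd (fst z + snd z, fst z - snd z))\<^sup>2)"
      by (simp flip: nat_add_distrib)
  qed simp
  also have "\<dots> = theta_even\<^sup>2"
    unfolding power2_eq_square[of theta_even] unfolding theta_even_def
    by (subst gen_fun_mult) (auto intro!: finite_fibres_square finite_fibres_square1)
  finally show ?thesis .
qed

lemma theta_wronskian:
  "fps_X * fps_deriv theta_odd2 * theta_even2 - theta_odd2 * (fps_X * fps_deriv theta_even2) = 4 * theta_odd_weighted\<^sup>2"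
proof -
  let ?h2 = "\<lambda>z. nat (2 * (fst z)\<^sup>2) + nat (2 * (snd z)\<^sup>2)"
  let ?w = "\<lambda>z::int\<times>int. of_int (2 * (fst z)\<^sup>2 - 2 * (snd z)\<^sup>2) :: rat"
  let ?S = "\<lambda>r. {z :: int \<times> int. odd (fst z) \<and> even (snd z) \<and> (fst z + snd z) mod 4 = r}"
  let ?M = "{c::int. c mod 4 = 1}"
  have fin: "finite_fibres ?h2 (A \<times> B)" for A B by (intro finite_fibres_Times finite_fibres_square) auto
  have fin': "finite_fibres ?h2 A" for A by (rule finite_fibres_subset[OF fin[of UNIV UNIV]]) auto
  have h2: "?h2 (a, b) = nat (c\<^sup>2) + nat (d\<^sup>2)" if "\<bar>c\<bar> = \<bar>a + b\<bar>" "\<bar>d\<bar> = \<bar>a - b\<bar>" for a b c d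
  proof -
    have "c\<^sup>2 + d\<^sup>2 = (a + b)\<^sup>2 + (a - b)\<^sup>2" using that by (metis power2_abs)
    hence "2 * a\<^sup>2 + 2 * b\<^sup>2 = c\<^sup>2 + d\<^sup>2" by (simp add: power2_eq_square algebra_simps)
    thus ?thesis by (simp flip: nat_add_distrib)
  qed
  have w: "2 * a\<^sup>2 - 2 * b\<^sup>2 = 2 * (a + b) * (a - b)" "2 * a\<^sup>2 - 2 * b\<^sup>2 = 2 * (- a - b) * (b - a)"
    for a b :: int by (simp_all add: power2_eq_square algebra_simps)
  have M: "gen_fun (\<lambda>z. of_int (2 * fst z * snd z)) (\<lambda>z. nat ((fst z)\<^sup>2) + nat ((snd z)\<^sup>2)) (?M \<times> ?M) = 2 * theta_odd_weighted\<^sup>2"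
  proof -
    have "2 * theta_odd_weighted\<^sup>2 = fps_const 2 * (theta_odd_weighted * theta_odd_weighted)" by (simp add: power2_eq_square numeral_fps_const)
    also have "theta_odd_weighted * theta_odd_weighted = gen_fun (\<lambda>z. of_int (fst z) * of_int (snd z))
        (\<lambda>z. nat ((fst z)\<^sup>2) + nat ((snd z)\<^sup>2)) (?M \<times> ?M)"
      unfolding theta_odd_weighted_def by (rule gen_fun_mult) (auto intro!: finite_fibres_square finite_fibres_square1)
    finally show ?thesis unfolding gen_fun_cmult by (simp add: mult.assoc)
  qed
  \<comment> \<open>The weight is 2(a + b)(a - b). As a is odd and b even, a + b and a - b are odd
    and congruent modulo 4; if both are 3 modulo 4, both get negated. Hence each class covers
    \<open>?M \<times> ?M\<close> exactly once.\<close>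
  have "gen_fun ?w ?h2 (?S 1) = 2 * theta_odd_weighted\<^sup>2"
    unfolding M[symmetric]
  proof (rule gen_fun_reindex[where f = "\<lambda>z. (fst z + snd z, fst z - snd z)"])
    show "bij_betw (\<lambda>z. (fst z + snd z, fst z - snd z)) (?S 1) (?M \<times> ?M)"
      by (rule bij_betwI[where g = "\<lambda>z. ((fst z + snd z) div 2, (fst z - snd z) div 2)"])
         (auto, presburger+)
  next
    fix z :: "int \<times> int"
    obtain a b where z: "z = (a, b)" by (cases z)
    show "?w z = of_int (2 * fst (fst z + snd z, fst z - snd z) * snd (fst z + snd z, fst z - snd z))"
      unfolding z fst_conv snd_conv by (subst w(1)) (rule refl)
    show "?h2 z = nat ((fst (fst z + snd z, fst z - snd z))\<^sup>2) + nat ((snd (fst z + snd z, fst z - snd z))\<^sup>2)"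
      unfolding z by (subst h2) (auto simp: abs_minus_commute)
  qed
  moreover have "gen_fun ?w ?h2 (?S 3) = 2 * theta_odd_weighted\<^sup>2"
    unfolding M[symmetric]
  proof (rule gen_fun_reindex[where f = "\<lambda>z. (- fst z - snd z, snd z - fst z)"])
    show "bij_betw (\<lambda>z. (- fst z - snd z, snd z - fst z)) (?S 3) (?M \<times> ?M)"
      by (rule bij_betwI[where g = "\<lambda>z. ((- fst z - snd z) div 2, (snd z - fst z) div 2)"])
         (auto, presburger+)
  next
    fix z :: "int \<times> int"
    obtain a b where z: "z = (a, b)" by (cases z)
    show "?w z = of_int (2 * fst (- fst z - snd z, snd z - fst z) * snd (- fst z - snd z, snd z - fst z))"
      unfolding z fst_conv snd_conv by (subst w(2)) (rule refl)
    show "?h2 z = nat ((fst (- fst z - snd z, snd z - fst z))\<^sup>2) + nat ((snd (- fst z - snd z, snd z - fst z))\<^sup>2)"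
      unfolding z by (subst h2) (auto simp: abs_minus_commute)
  qed
  moreover have "gen_fun ?w ?h2 (?S 1 \<union> ?S 3) = gen_fun ?w ?h2 (?S 1) + gen_fun ?w ?h2 (?S 3)"
    by (rule gen_fun_Un[OF fin' fin']) auto
  moreover have "?S 1 \<union> ?S 3 = {a. odd a} \<times> {b. even b}" by (auto, presburger)
  ultimately have "gen_fun ?w ?h2 ({a. odd a} \<times> {b. even b}) = 4 * theta_odd_weighted\<^sup>2" by simp
  moreover have "fps_X * fps_deriv theta_odd2 * theta_even2 - theta_odd2 * (fps_X * fps_deriv theta_even2) =
      gen_fun ?w ?h2 ({a. odd a} \<times> {b. even b})"
  proof -
    have "fps_X * fps_deriv theta_odd2 * theta_even2 = gen_fun (\<lambda>z. of_int (2 * (fst z)\<^sup>2)) ?h2 ({a. odd a} \<times> {b. even b})"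
      unfolding theta_odd2_def theta_even2_def gen_fun_theta
      by (subst gen_fun_mult) (auto intro!: finite_fibres_square simp: of_nat_nat)
    moreover have "theta_odd2 * (fps_X * fps_deriv theta_even2) = gen_fun (\<lambda>z. of_int (2 * (snd z)\<^sup>2)) ?h2 ({a. odd a} \<times> {b. even b})"
      unfolding theta_odd2_def theta_even2_def gen_fun_theta
      by (subst gen_fun_mult) (auto intro!: finite_fibres_square simp: of_nat_nat)
    ultimately show ?thesis
      by (simp add: diff_conv_add_uminus gen_fun_uminus gen_fun_add del: add_uminus_conv_diff)
  qed
  ultimately show ?thesis by simp
qed

section \<open>Congruences between coefficients of powers of an integral power series\<close>

text \<open>The cofactor of a - b in a^p - b^p is a sum of p terms, all congruent to b^(p-1) modulo
  p. The ring is general because the use is for power series.\<close>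

lemma prime_power_lift:
  fixes a b :: "'a::comm_ring_1"
  assumes "e > 0" "of_nat p ^ e dvd a - b"
  shows "of_nat p ^ Suc e dvd a ^ p - b ^ p"
proof -
  have p: "of_nat p dvd a - b" using assms by (meson dvd_power dvd_trans)
  have "of_nat p dvd b ^ (p - Suc i) * a ^ i - b ^ (p - 1)" if "i < p" for i
  proof -
    have "a - b dvd a ^ i - b ^ i" by (simp add: power_diff_sumr2)
    hence "of_nat p dvd b ^ (p - Suc i) * (a ^ i - b ^ i)" using p by (meson dvd_mult dvd_trans)
    moreover have "b ^ (p - Suc i) * b ^ i = b ^ (p - 1)" using that by (simp flip: power_add)
    ultimately show ?thesis by (simp add: right_diff_distrib)
  qed
  hence "of_nat p dvd (\<Sum>i<p. b ^ (p - Suc i) * a ^ i - b ^ (p - 1)) + of_nat p * b ^ (p - 1)"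
    by (intro dvd_add dvd_sum) auto
  hence "of_nat p dvd (\<Sum>i<p. b ^ (p - Suc i) * a ^ i)" by (simp add: sum_subtractf)
  thus ?thesis using assms(2) by (simp add: power_diff_sumr2 mult.commute[of "of_nat p"] mult_dvd_mono)
qed

lemma prime_power_lift_iterate:
  fixes a b :: "'a::comm_ring_1"
  assumes "of_nat p dvd a - b" "p ^ v dvd i"
  shows "of_nat p ^ Suc v dvd a ^ i - b ^ i"
proof -
  have 1: "of_nat p ^ Suc w dvd a ^ (p ^ w) - b ^ (p ^ w)" for w
  proof (induction w)
    case (Suc w)
    from prime_power_lift[OF _ this] show ?case by (simp add: power_mult[symmetric] mult.commute)
  qed (use assms in simp)
  obtain u where u: "i = p ^ v * u" using assms by auto
  have "a ^ (p ^ v) - b ^ (p ^ v) dvd (a ^ (p ^ v)) ^ u - (b ^ (p ^ v)) ^ u"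
    by (simp only: power_diff_sumr2 dvd_triv_left)
  with 1[of v] show ?thesis unfolding u power_mult by (rule dvd_trans)
qed

lemma prime_dvd_binomial_expansion:
  fixes f h :: "'a::comm_ring_1"
  assumes "prime p"
  shows "of_nat p dvd (f + h) ^ p - (f ^ p + h ^ p)"
proof -
  have p0: "p > 0" using assms prime_gt_0_nat by blast
  have "(f + h) ^ p = (\<Sum>k\<in>insert 0 (insert p {0<..<p}). of_nat (p choose k) * f ^ k * h ^ (p - k))"
    unfolding binomial_ring by (rule sum.cong) (use p0 in auto)
  also have "\<dots> = h ^ p + (f ^ p + (\<Sum>k\<in>{0<..<p}. of_nat (p choose k) * f ^ k * h ^ (p - k)))"
    using p0 by simp
  finally have "(f + h) ^ p - (f ^ p + h ^ p) = (\<Sum>k\<in>{0<..<p}. of_nat (p choose k) * f ^ k * h ^ (p - k))"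
    by simp
  also have "of_nat p dvd \<dots>"
  proof (intro dvd_sum)
    fix k assume "k \<in> {0<..<p}"
    hence "p dvd p choose k" using assms by (intro dvd_choose_prime) auto
    hence "of_nat p dvd (of_nat (p choose k) :: 'a)" by (auto simp: of_nat_mult)
    thus "of_nat p dvd of_nat (p choose k) * f ^ k * h ^ (p - k)" by (simp add: mult.assoc)
  qed
  finally show ?thesis .
qed

lemma of_nat_dvd_fps_nth:
  fixes f :: "int fps"
  assumes "of_nat c dvd f"
  shows "int c dvd f $ n"
proof -
  obtain h where "f = of_nat c * h" using assms by (elim dvdE)
  thus ?thesis by (simp add: fps_mult_of_nat_nth)
qed

lemma of_nat_dvd_fpsI:
  fixes f :: "int fps"
  assumes "\<And>n. int c dvd f $ n"
  shows "of_nat c dvd f"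
proof
  show "f = of_nat c * Abs_fps (\<lambda>n. f $ n div int c)"
    by (rule fps_ext) (simp add: fps_mult_of_nat_nth assms)
qed

text \<open>The series with this property are closed under addition and negation and include the
  powers of X, hence all integer polynomials; coefficient n sees only a truncation of s.\<close>

theorem frobenius_congruence:
  fixes s :: "int fps"
  assumes p: "prime p" and "odd p"
  shows "of_nat p dvd s ^ p - (s oo fps_X ^ p)"
proof (rule of_nat_dvd_fpsI)
  fix n
  have p0: "p > 0" using p prime_gt_0_nat by blast
  let ?Q = "\<lambda>f::int fps. of_nat p dvd f ^ p - (f oo fps_X ^ p)"
  have add: "?Q (f + h)" if "?Q f" "?Q h" for f h
  proof -
    have "(f + h) ^ p - (f + h oo fps_X ^ p) = ((f + h) ^ p - (f ^ p + h ^ p)) +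
        ((f ^ p - (f oo fps_X ^ p)) + (h ^ p - (h oo fps_X ^ p)))"
      by (simp add: fps_compose_add_distrib algebra_simps)
    thus ?thesis using that prime_dvd_binomial_expansion[OF p, of f h] by (metis dvd_add)
  qed
  have neg: "?Q (- f)" if "?Q f" for f
  proof -
    have "(- f) ^ p - (- f oo fps_X ^ p) = - (f ^ p - (f oo fps_X ^ p))"
      using \<open>odd p\<close> by (simp add: fps_compose_uminus)
    thus ?thesis using that by (metis dvd_minus_iff)
  qed
  have zero: "?Q 0" using p0 by (simp add: power_0_left)
  have "?Q (fps_X ^ k)" for k
    using p0 by (simp add: fps_X_power_compose power_mult[symmetric] mult.commute)
  hence nat: "?Q (of_nat m * fps_X ^ k)" for m k
    using zero by (induction m) (simp_all add: distrib_right add)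
  have mono: "?Q (fps_const c * fps_X ^ k)" for c k
  proof (cases "c \<ge> 0")
    case True
    thus ?thesis using nat[of "nat c" k] by (simp add: fps_of_nat[symmetric])
  next
    case False
    thus ?thesis using neg[OF nat[of "nat (- c)" k]]
      by (simp add: fps_of_nat[symmetric] flip: fps_const_neg)
  qed
  have Q: "?Q (\<Sum>k\<in>A. fps_const (s $ k) * fps_X ^ k)" if "finite A" for A
    using that by (induction A rule: finite_induct) (use p0 in \<open>auto simp: power_0_left add mono\<close>)
  define T where "T = (\<Sum>k\<in>{..n}. fps_const (s $ k) * fps_X ^ k)"
  have "agree (Suc n) s T"
    unfolding agree_def T_def
    by (auto simp: fps_sum_nth if_distrib[of "times _"] cong: if_cong)
  hence "agree (Suc n) (s ^ p) (T ^ p)" "agree (Suc n) (s oo fps_X ^ p) (T oo fps_X ^ p)"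
    using p0 by (auto intro: agree_power agree_compose_X_power)
  hence "(s ^ p - (s oo fps_X ^ p)) $ n = (T ^ p - (T oo fps_X ^ p)) $ n"
    by (simp add: agree_def)
  also have "int p dvd \<dots>" unfolding T_def by (intro of_nat_dvd_fps_nth Q) simp
  finally show "int p dvd (s ^ p - (s oo fps_X ^ p)) $ n" .
qed

text \<open>For j > 0 the coefficient of q^n in theta(s^j) / j, written without the division so that
  it stays integral.\<close>

definition theta_coeff :: "'a::comm_ring_1 fps \<Rightarrow> nat \<Rightarrow> nat \<Rightarrow> 'a" where
  "theta_coeff s j n = (s ^ (j - 1) * (fps_X * fps_deriv s)) $ n"

lemma mult_theta_coeff:
  "of_nat j * theta_coeff s j n = of_nat n * (s ^ j) $ n"
proof -
  have "of_nat n * (s ^ j) $ n = (fps_X * fps_deriv (s ^ j)) $ n"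
    by (cases n) simp_all
  also have "fps_X * fps_deriv (s ^ j) = fps_const (of_nat j) * (s ^ (j - 1) * (fps_X * fps_deriv s))"
    by (simp add: fps_deriv_power mult_ac)
  finally show ?thesis by (simp add: theta_coeff_def)
qed

lemma prime_power_dvd_cancel:
  fixes x :: int
  assumes "prime p" "\<not> p dvd u" "int p ^ M dvd int u * x"
  shows "int p ^ M dvd x"
proof -
  have "coprime p u" by (rule prime_imp_coprime) fact+
  hence "coprime (int p ^ M) (int u)" by simp
  thus ?thesis using assms(3) coprime_dvd_mult_right_iff by blast
qed

text \<open>Since j times \<open>theta_coeff s j n\<close> is a multiple of n, the terms with p not
  dividing j vanish modulo p^M. For j = p i the Frobenius congruence, raised to the power i, matches
  the term with the i-th term at n / p. The comparison of B with A is demanded only to the precision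
  p^v(p i), as the remaining powers of p come from n / j.\<close>

theorem theta_coeff_congruence:
  fixes s :: "int fps" and A B :: "nat \<Rightarrow> int"
  assumes p: "prime p" "odd p" and M: "M > 0"
    and AB: "\<And>i r. i > 0 \<Longrightarrow> r \<le> M \<Longrightarrow> p ^ r dvd p * i \<Longrightarrow> int p ^ r dvd B (p * i) - \<gamma> * A i"
    and n: "p ^ M dvd n"
  shows "int p ^ M dvd (\<Sum>j\<in>{1..n}. B j * theta_coeff s j n) -
           \<gamma> * (\<Sum>i\<in>{1..n div p}. A i * theta_coeff s i (n div p))"
proof -
  have p0: "p > 0" using p prime_gt_0_nat by blast
  have pM: "p dvd n" using n M by (meson dvd_power dvd_trans)
  have nM: "int p ^ M dvd int n" using n by (metis of_nat_dvd_iff of_nat_power)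
  have zero: "int p ^ M dvd B j * theta_coeff s j n" if "\<not> p dvd j" for j
  proof -
    have "int p ^ M dvd int j * theta_coeff s j n"
      by (subst mult_theta_coeff) (rule dvd_mult2[OF nM])
    thus ?thesis by (rule dvd_mult[OF prime_power_dvd_cancel[OF p(1) that]])
  qed
  have main: "int p ^ M dvd B (p * i) * theta_coeff s (p * i) n -
      \<gamma> * A i * theta_coeff s i (n div p)" if i: "i > 0" for i
  proof -
    define v where "v = multiplicity p i"
    have "\<not> is_unit p" using p(1) by (simp add: prime_nat_iff)
    then obtain u where u: "i = p ^ v * u" "\<not> p dvd u"
      unfolding v_def using i multiplicity_decompose'[of i p] by (metis not_gr_zero)
    let ?t = "theta_coeff s (p * i) n" and ?t' = "theta_coeff s i (n div p)"
    have pi: "int (p * i) = int u * int p ^ Suc v" by (simp add: u(1))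
    \<comment> \<open>If v + 1 \<le> M, the coefficient difference supplies p^(v+1) and
      \<open>?t\<close> the rest of p^M; otherwise the difference alone suffices, by the hypothesis
      at r = M.\<close>
    have "int p ^ M dvd (B (p * i) - \<gamma> * A i) * ?t"
    proof (cases "Suc v \<le> M")
      case True
      have "int u * (int p ^ Suc v * ?t) = int (p * i) * ?t" by (simp only: pi mult.assoc)
      also have "\<dots> = int n * (s ^ (p * i)) $ n" by (rule mult_theta_coeff)
      finally have "int p ^ M dvd int u * (int p ^ Suc v * ?t)" using nM by (metis dvd_mult2)
      hence "int p ^ M dvd int p ^ Suc v * ?t" by (rule prime_power_dvd_cancel[OF p(1) u(2)])
      moreover have "int p ^ Suc v dvd B (p * i) - \<gamma> * A i"
        by (rule AB[OF i True]) (simp add: u(1))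
      hence "int p ^ Suc v * ?t dvd (B (p * i) - \<gamma> * A i) * ?t" by (rule mult_dvd_mono) simp
      ultimately show ?thesis by (rule dvd_trans)
    next
      case False
      have "p ^ M dvd p ^ Suc v" using False by (intro le_imp_power_dvd) simp
      hence "p ^ M dvd p * i" unfolding u(1) by (simp add: dvd_mult2 mult.assoc[symmetric])
      thus ?thesis using AB[OF i order_refl] by (simp add: dvd_mult2)
    qed
    \<comment> \<open>p i times this difference is n times a difference of i-th powers that is
      divisible by p^(v+1); this power cancels against the one in p i.\<close>
    moreover have "int p ^ M dvd ?t - ?t'"
    proof -
      let ?S = "s oo fps_X ^ p"
      have "of_nat p dvd s ^ p - ?S" by (rule frobenius_congruence[OF p])
      hence "of_nat p ^ Suc v dvd (s ^ p) ^ i - ?S ^ i"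
        by (rule prime_power_lift_iterate) (simp add: u(1))
      hence "of_nat (p ^ Suc v) dvd s ^ (p * i) - (s ^ i oo fps_X ^ p)"
        using p0 by (simp only: of_nat_power power_mult) (simp add: fps_compose_power)
      from of_nat_dvd_fps_nth[OF this, of n]
      have "int p ^ Suc v dvd (s ^ (p * i)) $ n - (s ^ i) $ (n div p)"
        using pM by (simp add: fps_nth_compose_X_power)
      then obtain \<delta> where \<delta>: "(s ^ (p * i)) $ n - (s ^ i) $ (n div p) = int p ^ Suc v * \<delta>" by auto
      have "int (p * i) * ?t' = int p * (int i * ?t')" by simp
      also have "\<dots> = int n * (s ^ i) $ (n div p)"
        using mult_theta_coeff[of i s "n div p"] pM by (simp add: mult.assoc[symmetric] flip: of_nat_mult)
      finally have "int (p * i) * (?t - ?t') = int n * (int p ^ Suc v * \<delta>)"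
        unfolding \<delta>[symmetric] using mult_theta_coeff[of "p * i" s n]
        by (simp add: right_diff_distrib)
      hence "int p ^ Suc v * (int u * (?t - ?t')) = int p ^ Suc v * (int n * \<delta>)"
        unfolding pi by (simp only: mult_ac)
      hence "int u * (?t - ?t') = int n * \<delta>" using p0 by simp
      thus ?thesis using nM prime_power_dvd_cancel[OF p(1) u(2)] by (metis dvd_mult2)
    qed
    hence "int p ^ M dvd \<gamma> * A i * (?t - ?t')" by simp
    ultimately have "int p ^ M dvd (B (p * i) - \<gamma> * A i) * ?t + \<gamma> * A i * (?t - ?t')" by (rule dvd_add)
    thus ?thesis by (simp add: algebra_simps)
  qed
  have "{1..n} = {j\<in>{1..n}. \<not> p dvd j} \<union> (\<lambda>i. p * i) ` {1..n div p}"
    using p0 pM by (auto simp: image_iff div_le_mono elim!: dvdE)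
  hence "(\<Sum>j\<in>{1..n}. B j * theta_coeff s j n) =
      (\<Sum>j\<in>{j\<in>{1..n}. \<not> p dvd j}. B j * theta_coeff s j n) +
      (\<Sum>j\<in>(\<lambda>i. p * i) ` {1..n div p}. B j * theta_coeff s j n)"
    by (metis (no_types, lifting) sum.union_disjoint[of "{j\<in>{1..n}. \<not> p dvd j}" "(\<lambda>i. p * i) ` {1..n div p}"]
         finite_Un finite_atLeastAtMost disjoint_iff imageE mem_Collect_eq dvd_triv_left)
  also have "(\<Sum>j\<in>(\<lambda>i. p * i) ` {1..n div p}. B j * theta_coeff s j n) =
      (\<Sum>i\<in>{1..n div p}. B (p * i) * theta_coeff s (p * i) n)"
    using p0 by (subst sum.reindex) (auto simp: inj_on_def)
  finally have "(\<Sum>j\<in>{1..n}. B j * theta_coeff s j n) -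
           \<gamma> * (\<Sum>i\<in>{1..n div p}. A i * theta_coeff s i (n div p)) =
      (\<Sum>j\<in>{j\<in>{1..n}. \<not> p dvd j}. B j * theta_coeff s j n) +
      (\<Sum>i\<in>{1..n div p}. B (p * i) * theta_coeff s (p * i) n -
      \<gamma> * A i * theta_coeff s i (n div p))"
    by (simp add: sum_subtractf sum_distrib_left mult.assoc)
  also have "int p ^ M dvd \<dots>" by (intro dvd_add dvd_sum zero main) auto
  finally show ?thesis .
qed

section \<open>A congruence for central binomial coefficients\<close>

text \<open>The coefficients of (1 + 4x)^(-1/2).\<close>

definition central :: "nat \<Rightarrow> int" where
  "central k = (-1) ^ k * int ((2 * k) choose k)"

lemma central_0 [simp]: "central 0 = 1"
  by (simp add: central_def)

lemma central_Suc: "int (Suc k) * central (Suc k) = -2 * int (2 * k + 1) * central k"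
proof -
  have 1: "Suc k * (Suc (Suc (2 * k)) choose Suc k) = Suc (Suc (2 * k)) * (Suc (2 * k) choose k)"
    by (rule Suc_times_binomial)
  have "(Suc (2 * k) choose k) = (Suc (2 * k) choose (Suc (2 * k) - k))"
    by (rule binomial_symmetric) simp
  also have "Suc (2 * k) - k = Suc k" by simp
  finally have 2: "Suc k * (Suc (2 * k) choose k) = Suc (2 * k) * ((2 * k) choose k)"
    using Suc_times_binomial[of k "2 * k"] by simp
  have "Suc k * ((2 * Suc k) choose Suc k) = 2 * (Suc k * (Suc (2 * k) choose k))"
    using 1 by (simp only: mult_Suc_right add_2_eq_Suc) (simp add: algebra_simps)
  also have "\<dots> = 2 * Suc (2 * k) * ((2 * k) choose k)"
    unfolding 2 by (simp only: mult.assoc)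
  finally have "int (Suc k) * int ((2 * Suc k) choose Suc k) = 2 * int (Suc (2 * k)) * int ((2 * k) choose k)"
    by (metis of_nat_mult of_nat_numeral)
  hence "(-1) ^ Suc k * (int (Suc k) * int ((2 * Suc k) choose Suc k)) =
      (-1) ^ Suc k * (2 * int (2 * k + 1) * int ((2 * k) choose k))" by simp
  thus ?thesis unfolding central_def by (simp only: power_Suc mult_ac mult_minus_left mult_minus_right mult_1)
qed

text \<open>Exhibits a quotient of products over two arithmetic progressions, in which multiples of
  p can be counted.\<close>

lemma central_fact: "central k * fact k = (-2) ^ k * (\<Prod>i<k. int (2 * i + 1))"
proof (induction k)
  case (Suc k)
  have "central (Suc k) * fact (Suc k) = (int (Suc k) * central (Suc k)) * fact k"
    by (simp add: mult_ac)
  also have "\<dots> = -2 * int (2 * k + 1) * (central k * fact k)"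
    unfolding central_Suc by (simp only: mult_ac)
  finally show ?case unfolding Suc.IH by (simp add: algebra_simps)
qed simp

text \<open>Multiples of p are dropped entirely instead of being stripped of p, so that for e > 0
  the value modulo p^e depends only on x modulo p^e.\<close>

definition unit_part :: "nat \<Rightarrow> int \<Rightarrow> int" where
  "unit_part p x = (if int p dvd x then 1 else x)"

definition odd_units :: "nat \<Rightarrow> nat \<Rightarrow> int" where
  "odd_units p k = (\<Prod>i<k. unit_part p (int (2 * i + 1)))"

text \<open>Written with \<open>1 * i + 1\<close> so that both products run over progressions a i +
  1, which \<open>units_shift\<close> treats together.\<close>

definition fact_units :: "nat \<Rightarrow> nat \<Rightarrow> int" where
  "fact_units p k = (\<Prod>i<k. unit_part p (int (1 * i + 1)))"

lemma prod_unit_part: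
  assumes "finite J"
  shows "(\<Prod>i\<in>J. f i) = (\<Prod>i\<in>J. unit_part p (f i)) * (\<Prod>i\<in>{i\<in>J. int p dvd f i}. f i)"
proof -
  have "(\<Prod>i\<in>J. f i) = (\<Prod>i\<in>J. unit_part p (f i) * (if int p dvd f i then f i else 1))"
    by (intro prod.cong) (auto simp: unit_part_def)
  also have "\<dots> = (\<Prod>i\<in>J. unit_part p (f i)) * (\<Prod>i\<in>{i\<in>J. int p dvd f i}. f i)"
    using assms by (simp add: prod.distrib prod.inter_filter)
  finally show ?thesis .
qed

text \<open>As c + 1 < p, the multiples of p up to p l + c + 1 are p, 2p, ..., l p.\<close>

lemma fact_units_mult:
  assumes p: "p = 4 * c + 3"
  shows "fact (p * l + Suc c) = fact_units p (p * l + Suc c) * (int p ^ l * fact l)"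
proof -
  have set: "{i\<in>{..<p * l + Suc c}. int p dvd int (1 * i + 1)} = (\<lambda>j. p * j + (4 * c + 2)) ` {..<l}"
  proof (intro equalityI subsetI)
    fix i assume "i \<in> {i\<in>{..<p * l + Suc c}. int p dvd int (1 * i + 1)}"
    hence i: "i < p * l + Suc c" "p dvd i + 1"
      by (simp_all only: of_nat_dvd_iff lessThan_iff mem_Collect_eq mult_1)
    from i(2) obtain d where d: "i + 1 = p * d" by (elim dvdE)
    then obtain j where j: "d = Suc j" by (cases d) auto
    have ij: "i = p * j + (4 * c + 2)" using d p by (simp add: j)
    have "p * j < p * l" using i(1) unfolding ij by linarith
    thus "i \<in> (\<lambda>j. p * j + (4 * c + 2)) ` {..<l}" using ij by simp
  next
    fix i assume "i \<in> (\<lambda>j. p * j + (4 * c + 2)) ` {..<l}"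
    then obtain j where j: "j < l" "i = p * j + (4 * c + 2)" by auto
    have i: "i + 1 = p * Suc j" using j p by simp
    moreover have "p * Suc j \<le> p * l" using j(1) by (intro mult_le_mono2) simp
    ultimately have "i < p * l + Suc c" by linarith
    moreover have "int p dvd int (1 * i + 1)"
      unfolding mult_1 i by (simp only: of_nat_dvd_iff dvd_triv_left)
    ultimately show "i \<in> {i\<in>{..<p * l + Suc c}. int p dvd int (1 * i + 1)}" by blast
  qed
  have "fact n = (\<Prod>i<n. int (1 * i + 1))" for n
    by (induction n) (simp_all add: algebra_simps)
  hence "fact (p * l + Suc c) = (\<Prod>i<p * l + Suc c. int (1 * i + 1))" .
  also have "\<dots> = fact_units p (p * l + Suc c) * (\<Prod>j<l. int (1 * (p * j + (4 * c + 2)) + 1))"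
    unfolding fact_units_def
    by (subst prod_unit_part[where p = p], simp, subst set, subst prod.reindex)
       (use p in \<open>auto simp: inj_on_def\<close>)
  also have "(\<Prod>j<l. int (1 * (p * j + (4 * c + 2)) + 1)) = (\<Prod>j<l. int p * int (Suc j))"
    by (intro prod.cong refl) (simp add: p algebra_simps)
  also have "\<dots> = int p ^ l * fact l"
    unfolding prod.distrib by (simp add: fact_prod_Suc atLeast0LessThan)
  finally show ?thesis .
qed

text \<open>The odd multiple p(2j + 1) sits at i = p j + 2c + 1; since 2c + 1 \<ge> c + 1, exactly
  those with j < l occur. The count equals that in the factorial, so the factors p^l cancel in
  \<open>central_units\<close>.\<close>

lemma odd_units_mult:
  assumes p: "p = 4 * c + 3"
  shows "(\<Prod>i<p * l + Suc c. int (2 * i + 1)) =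
    odd_units p (p * l + Suc c) * (int p ^ l * (\<Prod>i<l. int (2 * i + 1)))"
proof -
  have p2: "2 * (p * j + (2 * c + 1)) + 1 = p * (2 * j + 1)" for j by (simp add: p algebra_simps)
  have set: "{i\<in>{..<p * l + Suc c}. int p dvd int (2 * i + 1)} = (\<lambda>j. p * j + (2 * c + 1)) ` {..<l}"
  proof (intro equalityI subsetI)
    fix i assume "i \<in> {i\<in>{..<p * l + Suc c}. int p dvd int (2 * i + 1)}"
    hence i: "i < p * l + Suc c" "p dvd 2 * i + 1"
      by (simp_all only: of_nat_dvd_iff lessThan_iff mem_Collect_eq)
    from i(2) obtain d where d: "2 * i + 1 = p * d" by (elim dvdE)
    have "odd (p * d)" unfolding d[symmetric] by simp
    hence "odd d" by simp
    then obtain j where j: "d = 2 * j + 1" by (elim oddE)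
    have "2 * i + 1 = 2 * (p * j + (2 * c + 1)) + 1" unfolding p2 d j ..
    hence ij: "i = p * j + (2 * c + 1)" by simp
    have "p * j < p * l" using i(1) unfolding ij by linarith
    thus "i \<in> (\<lambda>j. p * j + (2 * c + 1)) ` {..<l}" using ij by simp
  next
    fix i assume "i \<in> (\<lambda>j. p * j + (2 * c + 1)) ` {..<l}"
    then obtain j where j: "j < l" "i = p * j + (2 * c + 1)" by auto
    have "p * j + p \<le> p * l" using j(1) mult_le_mono2[of "Suc j" l p] by simp
    hence "i < p * l + Suc c" using p j(2) by linarith
    moreover have "int p dvd int (2 * i + 1)"
      unfolding j(2) p2 by (simp only: of_nat_dvd_iff dvd_triv_left)
    ultimately show "i \<in> {i\<in>{..<p * l + Suc c}. int p dvd int (2 * i + 1)}" by blast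
  qed
  have "(\<Prod>i<p * l + Suc c. int (2 * i + 1)) =
      odd_units p (p * l + Suc c) * (\<Prod>j<l. int (2 * (p * j + (2 * c + 1)) + 1))"
    unfolding odd_units_def
    by (subst prod_unit_part[where p = p], simp, subst set, subst prod.reindex)
       (use p in \<open>auto simp: inj_on_def\<close>)
  also have "(\<Prod>j<l. int (2 * (p * j + (2 * c + 1)) + 1)) = (\<Prod>j<l. int p * int (2 * j + 1))"
    unfolding p2 of_nat_mult ..
  finally show ?thesis unfolding prod.distrib by simp
qed

lemma central_units:
  assumes p: "p = 4 * c + 3"
  shows "central (p * l + Suc c) * fact_units p (p * l + Suc c) =
    central l * ((-2) ^ (p * l + Suc c - l) * odd_units p (p * l + Suc c))"
proof -
  let ?k = "p * l + Suc c"
  have p0: "p > 0" using p by simp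
  have "l \<le> p * l" using p0 by simp
  hence "l \<le> ?k" by linarith
  hence pow: "(-2) ^ ?k = (-2 :: int) ^ (?k - l) * (-2) ^ l" by (simp flip: power_add)
  have "central ?k * fact_units p ?k * (int p ^ l * fact l) = central ?k * fact ?k"
    unfolding fact_units_mult[OF p] by (simp only: mult_ac)
  also have "\<dots> = (-2) ^ (?k - l) * odd_units p ?k * int p ^ l * ((-2) ^ l * (\<Prod>i<l. int (2 * i + 1)))"
    unfolding central_fact odd_units_mult[OF p] pow by (simp only: mult_ac)
  also have "\<dots> = central l * ((-2) ^ (?k - l) * odd_units p ?k) * (int p ^ l * fact l)"
    unfolding central_fact[symmetric] by (simp only: mult_ac)
  finally show ?thesis using p0 by simp
qed

section \<open>Products of units along arithmetic progressions modulo p^e\<close>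

lemma unit_part_cong:
  assumes "int p dvd n" "[x = y] (mod n)"
  shows "[unit_part p x = unit_part p y] (mod n)"
proof -
  have "int p dvd x \<longleftrightarrow> int p dvd y"
    by (rule cong_dvd_iff[OF cong_dvd_modulus[OF assms(2) assms(1)]])
  thus ?thesis using assms(2) by (simp add: unit_part_def)
qed

text \<open>A progression whose difference is prime to p meets every residue class modulo p^e once
  in p^e steps.\<close>

lemma prod_unit_part_cong:
  assumes "p > 1" "e > 0" "\<not> p dvd a" "prime p"
  shows "[(\<Prod>i<p ^ e. unit_part p (int (a * i + b))) = (\<Prod>x<p ^ e. unit_part p (int x))] (mod int (p ^ e))"
proof -
  let ?n = "p ^ e"
  have n0: "?n > 0" using assms by simp
  have cop: "coprime a ?n" using assms by (metis coprime_commute coprime_power_right_iff prime_imp_coprime)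
  have inj: "inj_on (\<lambda>i. (a * i + b) mod ?n) {..<?n}"
  proof (rule inj_onI)
    fix i j assume ij: "i \<in> {..<?n}" "j \<in> {..<?n}" "(a * i + b) mod ?n = (a * j + b) mod ?n"
    hence "[a * i + b = a * j + b] (mod ?n)" by (simp add: cong_def)
    hence "[a * i = a * j] (mod ?n)" by (simp only: cong_add_rcancel_nat)
    hence "[i = j] (mod ?n)" using cop cong_mult_lcancel_nat by blast
    thus "i = j" using ij by (simp add: cong_def)
  qed
  have bij: "bij_betw (\<lambda>i. (a * i + b) mod ?n) {..<?n} {..<?n}"
    unfolding bij_betw_def
    by (intro conjI inj endo_inj_surj) (use n0 in auto)
  have "[(\<Prod>i<?n. unit_part p (int (a * i + b))) = (\<Prod>i<?n. unit_part p (int ((a * i + b) mod ?n)))] (mod int ?n)"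
  proof (intro cong_prod unit_part_cong)
    show "int p dvd int ?n" using assms by (simp add: dvd_power)
    show "[int (a * i + b) = int ((a * i + b) mod ?n)] (mod int ?n)" for i
      unfolding cong_int_iff by (simp add: cong_def)
  qed
  also have "(\<Prod>i<?n. unit_part p (int ((a * i + b) mod ?n))) = (\<Prod>x<?n. unit_part p (int x))"
    by (rule prod.reindex_bij_betw[OF bij, of "\<lambda>x. unit_part p (int x)"])
  finally show ?thesis .
qed

lemma prod_lessThan_add: "(\<Prod>i<k + n. f i) = (\<Prod>i<k. f i) * (\<Prod>i<n. f (k + i))" for n :: nat
  by (induction n) (simp_all add: mult.assoc)

lemma units_shift:
  assumes "p > 1" "e > 0" "\<not> p dvd a" "prime p"
  shows "[(\<Prod>i<k + p ^ e. unit_part p (int (a * i + 1))) =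
    (\<Prod>x<p ^ e. unit_part p (int x)) * (\<Prod>i<k. unit_part p (int (a * i + 1)))] (mod int (p ^ e))"
proof -
  let ?W = "\<Prod>x<p ^ e. unit_part p (int x)" and ?A = "\<Prod>i<k. unit_part p (int (a * i + 1))"
  have "[(\<Prod>i<p ^ e. unit_part p (int (a * i + (a * k + 1)))) * ?A = ?W * ?A] (mod int (p ^ e))"
    by (intro cong_mult cong_refl prod_unit_part_cong assms)
  moreover have "a * (k + i) + 1 = a * i + (a * k + 1)" for i by (simp add: algebra_simps)
  ultimately show ?thesis unfolding prod_lessThan_add by (simp only: mult.commute)
qed

lemma not_dvd_units:
  assumes "prime p"
  shows "\<not> int p dvd (\<Prod>i\<in>J. unit_part p (f i))"
proof -
  have p: "prime (int p)" "\<not> int p dvd 1" using assms by auto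
  have "\<not> int p dvd unit_part p x" for x using p(2) by (simp add: unit_part_def)
  thus ?thesis
    by (induction J rule: infinite_finite_induct) (use p(2) in \<open>simp_all add: prime_dvd_mult_iff[OF p(1)] \<open>\<And>x. \<not> int p dvd unit_part p x\<close>\<close>)
qed

text \<open>The unit parts of numerator and denominator of \<open>central (p l + c) / central l\<close>; modulo
  \<open>p ^ e\<close> both get multiplied by the product of all units when \<open>l\<close> increases by
  \<open>p ^ (e - 1)\<close>.\<close>

definition num_units :: "nat \<Rightarrow> nat \<Rightarrow> nat \<Rightarrow> int" where
  "num_units p c l = (-2) ^ (p * l + Suc c - l) * odd_units p (p * l + Suc c)"

definition den_units :: "nat \<Rightarrow> nat \<Rightarrow> nat \<Rightarrow> int" where
  "den_units p c l = fact_units p (p * l + Suc c)"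

lemma units_shift_iterate:
  fixes p c l t e :: nat
  assumes p: "prime p" "odd p"
  defines "W \<equiv> (\<Prod>x<p ^ Suc e. unit_part p (int x))"
  shows "[num_units p c (l + p ^ e * t) = W ^ t * num_units p c l] (mod int (p ^ Suc e))"
    and "[den_units p c (l + p ^ e * t) = W ^ t * den_units p c l] (mod int (p ^ Suc e))"
proof -
  have p1: "p > 1" using p(1) by (rule prime_gt_1_nat)
  have p2: "\<not> p dvd 2" "\<not> p dvd 1" using p p1 by (auto dest: dvd_imp_le simp: le_Suc_eq numeral_2_eq_2)
  have shift: "p * (m + p ^ e) + Suc c = p * m + Suc c + p ^ Suc e" for m by (simp add: algebra_simps)
  \<comment> \<open>When l grows by p^e, the exponent of -2 grows by p^(e+1) - p^e, the totient of
    p^(e+1). This is even, so the sign disappears.\<close>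
  have two: "[(-2) ^ (p ^ e * (p - 1)) = 1] (mod int (p ^ Suc e))"
  proof -
    have "coprime 2 (p ^ Suc e)" using p by simp
    from euler_theorem[OF this] have "[2 ^ (p ^ e * (p - 1)) = 1] (mod p ^ Suc e)"
      using p by (simp add: totient_prime_power_Suc del: power_Suc)
    hence "[int (2 ^ (p ^ e * (p - 1))) = int 1] (mod int (p ^ Suc e))" by (subst cong_int_iff)
    moreover have "even (p ^ e * (p - 1))" using p by simp
    ultimately show ?thesis by simp
  qed
  have step_num: "[num_units p c (m + p ^ e) = W * num_units p c m] (mod int (p ^ Suc e))" for m
  proof -
    have e: "p * m + Suc c + p ^ Suc e - (m + p ^ e) = (p * m + Suc c - m) + p ^ e * (p - 1)"
      unfolding shift[symmetric] using p1 by (cases p) (simp_all add: algebra_simps)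
    have "num_units p c (m + p ^ e) = (-2) ^ (p * m + Suc c - m) *
        ((-2) ^ (p ^ e * (p - 1)) * odd_units p (p * m + Suc c + p ^ Suc e))"
      unfolding num_units_def shift e power_add by (rule mult.assoc)
    also have "[\<dots> = (-2) ^ (p * m + Suc c - m) * (1 * (W * odd_units p (p * m + Suc c)))] (mod int (p ^ Suc e))"
      unfolding odd_units_def W_def
      by (intro cong_mult cong_refl two units_shift) (use p p1 p2 in auto)
    finally show ?thesis by (simp add: num_units_def mult_ac)
  qed
  have step_den: "[den_units p c (m + p ^ e) = W * den_units p c m] (mod int (p ^ Suc e))" for m
    unfolding den_units_def shift fact_units_def W_def
    by (rule units_shift) (use p p1 p2 in auto)
  show "[num_units p c (l + p ^ e * t) = W ^ t * num_units p c l] (mod int (p ^ Suc e))"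
  proof (induction t)
    case (Suc t)
    have "[num_units p c (l + p ^ e * t + p ^ e) = W * (W ^ t * num_units p c l)] (mod int (p ^ Suc e))"
      using step_num cong_mult[OF cong_refl Suc.IH] cong_trans by blast
    thus ?case by (simp add: mult_ac add_ac)
  qed simp
  show "[den_units p c (l + p ^ e * t) = W ^ t * den_units p c l] (mod int (p ^ Suc e))"
  proof (induction t)
    case (Suc t)
    have "[den_units p c (l + p ^ e * t + p ^ e) = W * (W ^ t * den_units p c l)] (mod int (p ^ Suc e))"
      using step_den cong_mult[OF cong_refl Suc.IH] cong_trans by blast
    thus ?case by (simp add: mult_ac add_ac)
  qed simp
qed

text \<open>Both products acquire the same factor, so their quotient at precision p^(e+1) depends on
  l only modulo p^e. Cross-multiplication keeps this in the integers.\<close>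

lemma units_cross_cong:
  assumes p: "prime p" "odd p" and l: "[l = l'] (mod p ^ e)"
  shows "[num_units p c l * den_units p c l' = num_units p c l' * den_units p c l] (mod int (p ^ Suc e))"
proof -
  have *: "[num_units p c (l + p ^ e * t) * den_units p c l = num_units p c l * den_units p c (l + p ^ e * t)]
      (mod int (p ^ Suc e))" for l t
  proof -
    let ?W = "\<Prod>x<p ^ Suc e. unit_part p (int x)"
    have 1: "[num_units p c (l + p ^ e * t) * den_units p c l = ?W ^ t * num_units p c l * den_units p c l]
        (mod int (p ^ Suc e))"
      by (rule cong_mult[OF units_shift_iterate(1)[OF p] cong_refl])
    have 2: "[num_units p c l * den_units p c (l + p ^ e * t) = num_units p c l * (?W ^ t * den_units p c l)]
        (mod int (p ^ Suc e))"
      by (rule cong_mult[OF cong_refl units_shift_iterate(2)[OF p]])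
    have 3: "?W ^ t * num_units p c l * den_units p c l = num_units p c l * (?W ^ t * den_units p c l)"
      by (simp only: mult_ac)
    show ?thesis by (rule cong_trans[OF 1[unfolded 3] cong_sym[OF 2]])
  qed
  show ?thesis
  proof (cases "l' \<le> l")
    case True
    then obtain t where "l = t * p ^ e + l'" using l cong_le_nat[of l' l] by blast
    hence "l = l' + p ^ e * t" by simp
    thus ?thesis using *[of l' t] by simp
  next
    case False
    then obtain t where "l' = t * p ^ e + l"
      using cong_sym[OF l] cong_le_nat[of l l'] by auto
    hence "l' = l + p ^ e * t" by simp
    thus ?thesis using cong_sym[OF *[of l t]] by simp
  qed
qed

text \<open>With \<open>s = L(2z) powr (- 1/2)\<close> and \<open>\<theta> = q d/dq\<close>, these are the coefficients in
  \<open>g = (\<Sum>i. coeffA i * s ^ (i - 1)) * \<theta> s\<close> and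
  \<open>F = \<theta> (1 / s) + (\<Sum>j. coeffB j * s ^ (j - 1)) * \<theta> s\<close>.\<close>

definition coeffA :: "nat \<Rightarrow> int" where
  "coeffA i = (if i mod 4 = 1 then central (i div 4) else 0)"

definition coeffB :: "nat \<Rightarrow> int" where
  "coeffB j = (if j mod 4 = 3 then - central (Suc (j div 4)) else 0)"

lemma coeffA_simp: "coeffA (4 * k + 1) = central k"
proof -
  have "(4 * k + 1) div 4 = k" "(4 * k + 1) mod 4 = 1" by presburger+
  thus ?thesis unfolding coeffA_def by presburger
qed

lemma coeffB_simp: "coeffB (4 * k + 3) = - central (Suc k)"
  by (simp add: coeffB_def)

lemma ratio_cross_dvd:
  fixes m :: int
  assumes "b * D = a * N" "[N * D' = N' * D] (mod m)" "[D' * \<gamma> = - N'] (mod m)"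
  shows "m dvd D * D' * (- b - \<gamma> * a)"
proof -
  have "D * D' * (- b - \<gamma> * a) = - D' * (b * D) - a * D * D' * \<gamma>"
    by (simp add: algebra_simps)
  also have "\<dots> = - a * (N * D' - N' * D) - a * D * (D' * \<gamma> - - N')"
    unfolding assms(1) by (simp add: algebra_simps)
  also have "m dvd \<dots>"
    by (rule dvd_diff[OF dvd_mult dvd_mult]) (use assms in \<open>simp_all only: cong_iff_dvd_diff\<close>)
  finally show ?thesis .
qed

text \<open>For i = 4l + 1 and p = 4c + 3 one has p i = 4(p l + c) + 3, so gamma has to be minus the
  quotient of \<open>num_units\<close> by \<open>den_units\<close>. If p^r divides p i, then l is
  -1/4 modulo p^(r-1), so evaluating this quotient at a single l0 that is -1/4 modulo p^(M-1) serves
  all i.\<close>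

theorem coeff_unit_ratio:
  assumes p: "prime p" "p mod 4 = 3" and M: "M > 0"
  obtains \<gamma> where "\<not> int p dvd \<gamma>"
    "\<And>i r. r \<le> M \<Longrightarrow> p ^ r dvd p * i \<Longrightarrow> int p ^ r dvd coeffB (p * i) - \<gamma> * coeffA i"
proof -
  define c where "c = p div 4"
  have pc: "p = 4 * c + 3" using p(2) unfolding c_def by presburger
  have odd: "odd p" using p(2) by presburger
  let ?N = "num_units p c" and ?D = "den_units p c"
  have D: "coprime (?D l) (int p ^ e)" for l e
  proof -
    have "\<not> int p dvd ?D l" unfolding den_units_def fact_units_def by (rule not_dvd_units) fact
    thus ?thesis using p(1) by (simp add: coprime_commute prime_imp_coprime)
  qed
  have N: "\<not> int p dvd ?N l" for l
  proof -
    have "\<not> int p dvd odd_units p (p * l + Suc c)" unfolding odd_units_def by (rule not_dvd_units) fact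
    moreover have "\<not> int p dvd (-2) ^ k" for k
    proof
      assume "int p dvd (-2) ^ k"
      hence "int p dvd 2" using p(1) prime_dvd_power[of "int p" "-2" k] by simp
      hence "p dvd 2" by presburger
      thus False using dvd_imp_le[of p 2] pc by simp
    qed
    ultimately show ?thesis unfolding num_units_def using p(1) by (simp add: prime_dvd_mult_iff)
  qed
  \<comment> \<open>An explicit -1/4 modulo p^(M-1): the square of an odd number is 1 modulo
    4.\<close>
  define l0 where "l0 = (p ^ (M - 1) * p ^ (M - 1)) div 4"
  have l0: "4 * l0 + 1 = p ^ (M - 1) * p ^ (M - 1)"
  proof -
    obtain d where "p ^ (M - 1) = 2 * d + 1" using odd by (metis oddE even_power)
    hence "p ^ (M - 1) * p ^ (M - 1) = 4 * (d * d + d) + 1" by (simp add: algebra_simps)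
    thus ?thesis unfolding l0_def by presburger
  qed
  obtain y where y: "[?D l0 * y = 1] (mod int p ^ M)" using cong_solve_coprime_int[OF D] by blast
  define \<gamma> where "\<gamma> = - ?N l0 * y"
  have \<gamma>: "[?D l0 * \<gamma> = - ?N l0] (mod int p ^ M)"
    using cong_mult[OF cong_refl[of "- ?N l0"] y] by (simp add: \<gamma>_def mult_ac)
  show ?thesis
  proof (rule that)
    show "\<not> int p dvd \<gamma>"
    proof
      assume "int p dvd \<gamma>"
      moreover have "int p dvd int p ^ M" using M by simp
      ultimately show False
        using \<gamma> N[of l0] by (metis cong_dvd_iff cong_dvd_modulus dvd_minus_iff dvd_mult)
    qed
  next
    fix i r assume r: "r \<le> M" "p ^ r dvd p * i"
    show "int p ^ r dvd coeffB (p * i) - \<gamma> * coeffA i"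
    proof (cases "i mod 4 = 1")
      case False
      \<comment> \<open>Multiplication by p sends only the class 1 modulo 4 to 3, so here both
        coefficients vanish.\<close>
      have "(p * i) mod 4 = (3 * (i mod 4)) mod 4" using p(2) by (metis mod_mult_eq mod_mult_right_eq)
      moreover have "i mod 4 = 0 \<or> i mod 4 = 2 \<or> i mod 4 = 3" using False by auto
      ultimately have "(p * i) mod 4 \<noteq> 3" by (elim disjE) simp_all
      thus ?thesis using False by (simp add: coeffA_def coeffB_def)
    next
      case True
      define l where "l = i div 4"
      have i: "i = 4 * l + 1" using True by (simp add: l_def) presburger
      have pi: "p * i = 4 * (p * l + c) + 3" using pc by (simp add: i algebra_simps)
      have B: "coeffB (p * i) = - central (p * l + Suc c)"
        unfolding pi coeffB_simp by simp
      have A: "coeffA i = central l" unfolding i by (rule coeffA_simp)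
      show ?thesis
      proof (cases r)
        case (Suc e)
        have "p * p ^ e dvd p * i" using r(2) by (simp only: Suc power_Suc)
        hence "p ^ e dvd i" using pc by simp
        hence "p ^ e dvd 4 * l + 1" by (simp only: i)
        moreover have "p ^ e dvd 4 * l0 + 1"
          unfolding l0 using r(1) Suc by (intro dvd_mult2 le_imp_power_dvd) simp
        ultimately have "[4 * l + 1 = 4 * l0 + 1] (mod p ^ e)" by (metis cong_0_iff cong_sym cong_trans)
        hence 4: "[4 * l = 4 * l0] (mod p ^ e)" by (simp only: cong_add_rcancel_nat)
        have "coprime 2 (p ^ e)" using odd by simp
        hence "coprime (2 * 2) (p ^ e)" by (simp only: coprime_mult_left_iff)
        hence "coprime 4 (p ^ e)" by simp
        with 4 have "[l = l0] (mod p ^ e)" by (simp only: cong_mult_lcancel_nat)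
        from units_cross_cong[OF p(1) odd this, of c]
        have cross: "[?N l * ?D l0 = ?N l0 * ?D l] (mod int p ^ r)" by (simp add: Suc)
        have \<gamma>': "[?D l0 * \<gamma> = - ?N l0] (mod int p ^ r)"
          using \<gamma> r(1) by (meson cong_dvd_modulus le_imp_power_dvd)
        have "int p ^ r dvd ?D l * ?D l0 * (coeffB (p * i) - \<gamma> * coeffA i)"
          unfolding A B
          by (rule ratio_cross_dvd[OF _ cross \<gamma>'])
             (use central_units[OF pc, of l] in \<open>simp only: num_units_def den_units_def\<close>)
        moreover have "coprime (int p ^ r) (?D l * ?D l0)"
          using D[of l r] D[of l0 r] by (simp only: coprime_mult_right_iff coprime_commute)
        ultimately show ?thesis by (simp only: coprime_dvd_mult_right_iff)
      qed simp
    qed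
  qed
qed

section \<open>The uniformizer and the forms \<open>g\<close> and \<open>F\<close>\<close>

definition g_fps :: "rat fps" where
  "g_fps = fps_X * euler_at 4 ^ 2 * euler_at 8 ^ 2"

text \<open>The local parameter \<open>L(2z) powr (- 1/2)\<close> at infinity.\<close>

definition unif :: "rat fps" where
  "unif = fps_X * (euler_at 8 * euler_at 32 ^ 2 * inverse (euler_at 16) ^ 3)"

lemma unif_euler: "unif * euler_at 16 ^ 3 = fps_X * euler_at 8 * euler_at 32 ^ 2"
proof -
  have "inverse (euler_at 16) ^ 3 * euler_at 16 ^ 3 = (inverse (euler_at 16) * euler_at 16) ^ 3"
    by (simp only: power_mult_distrib)
  also have "\<dots> = 1" by (subst inverse_mult_eq_1) simp_all
  finally have 1: "inverse (euler_at 16) ^ 3 * euler_at 16 ^ 3 = 1" .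
  have "unif * euler_at 16 ^ 3 =
      fps_X * euler_at 8 * euler_at 32 ^ 2 * (inverse (euler_at 16) ^ 3 * euler_at 16 ^ 3)"
    unfolding unif_def by (simp only: mult_ac)
  thus ?thesis unfolding 1 by simp
qed

lemma unif_nth_0 [simp]: "unif $ 0 = 0"
  by (simp add: unif_def)

lemma unif_nonzero [simp]: "unif \<noteq> 0"
  using unif_euler by auto

lemma g_fps_theta: "g_fps = theta_odd_weighted * theta_even_alt"
proof -
  have "fps_X * euler_at 8 ^ 3 * theta_even_alt = fps_X * euler_at 8 ^ 2 * (theta_even_alt * euler_at 8)"
    by (simp add: power2_eq_square power3_eq_cube mult_ac)
  thus ?thesis unfolding theta_odd_weighted_product theta_even_alt_product g_fps_def by (simp only: mult_ac)
qed

text \<open>Makes s^2 half a quotient of theta series, which brings s within reach of the two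
  lattice identities.\<close>

lemma theta_odd2_unif: "theta_odd2 = 2 * theta_even2 * unif\<^sup>2"
proof -
  \<comment> \<open>Nonzero Euler products clear all denominators, leaving a polynomial consequence
    of the product formulas; the multipliers \<open>?K\<close> below have the same origin.\<close>
  have "(euler_at 16 ^ 6 * euler_at 8 ^ 2 * euler_at 32 ^ 2) * theta_odd2 =
      (euler_at 16 ^ 6 * euler_at 8 ^ 2 * euler_at 32 ^ 2) * (2 * theta_even2 * unif\<^sup>2)"
    using unif_euler theta_even2_product theta_odd2_product by Groebner_Basis.algebra
  thus ?thesis by simp
qed

lemma unif_curve: "theta_even2\<^sup>2 * (1 + 4 * unif ^ 4) = theta_even\<^sup>2"
  using theta_even2_thN_thC unfolding theta_odd2_unif by Groebner_Basis.algebra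

text \<open>As \<open>theta_odd2\<close> is 2 s^2 times \<open>theta_even2\<close>, their Wronskian
  is 4 s theta(s) times the square of \<open>theta_even2\<close>, and \<open>theta_wronskian\<close>
  evaluates it.\<close>

lemma theta_unif: "euler_at 16 ^ 7 * (fps_X * fps_deriv unif) = fps_X * euler_at 8 ^ 9 * euler_at 32 ^ 2"
proof -
  let ?K = "euler_at 16 ^ 3 * fps_X * euler_at 8 * euler_at 32 ^ 2"
  have "fps_deriv theta_odd2 = 2 * fps_deriv theta_even2 * unif\<^sup>2 + 4 * theta_even2 * unif * fps_deriv unif"
    unfolding theta_odd2_unif by (simp add: power2_eq_square algebra_simps)
  note D = this
  have "4 * (theta_even2\<^sup>2 * unif * (fps_X * fps_deriv unif)) =
      fps_X * fps_deriv theta_odd2 * theta_even2 - theta_odd2 * (fps_X * fps_deriv theta_even2)"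
    unfolding D by (simp add: theta_odd2_unif algebra_simps power2_eq_square)
  also have "\<dots> = 4 * (fps_X\<^sup>2 * euler_at 8 ^ 6)"
    unfolding theta_wronskian theta_odd_weighted_product by (simp add: power_mult_distrib flip: power_mult)
  finally have "theta_even2\<^sup>2 * unif * (fps_X * fps_deriv unif) = fps_X\<^sup>2 * euler_at 8 ^ 6" by simp
  hence "?K * (euler_at 16 ^ 7 * (fps_X * fps_deriv unif)) = ?K * (fps_X * euler_at 8 ^ 9 * euler_at 32 ^ 2)"
    using unif_euler theta_even2_product by Groebner_Basis.algebra
  thus ?thesis by simp
qed

text \<open>With \<open>unif_curve\<close> this is theta(s) = g sqrt(1 + 4 s^4), the root being the
  quotient of \<open>theta_even\<close> by \<open>theta_even2\<close>.\<close>

lemma g_fps_thC: "g_fps * theta_even = theta_even2 * (fps_X * fps_deriv unif)"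
proof -
  let ?K = "euler_at 4 ^ 2 * euler_at 16 ^ 9 * euler_at 8 ^ 2 * euler_at 32 ^ 2"
  have "?K * (g_fps * theta_even) = ?K * (theta_even2 * (fps_X * fps_deriv unif))"
    using theta_even_product theta_even2_product theta_unif unfolding g_fps_def by Groebner_Basis.algebra
  thus ?thesis by simp
qed

section \<open>The series (1 + 4 x^4)^(-1/2) and the expansions of g and F in s\<close>

definition serA :: "rat fps" where "serA = Abs_fps (\<lambda>i. of_int (coeffA (Suc i)))"
definition serB :: "rat fps" where "serB = Abs_fps (\<lambda>i. of_int (coeffB (Suc i)))"

text \<open>The recurrence for \<open>central\<close> is the differential equation (1 + 4x) c' =
  -2c, which makes c^2 (1 + 4x) constant.\<close>

lemma central_series: "Abs_fps (\<lambda>k. of_int (central k)) ^ 2 * (1 + 4 * fps_X) = (1 :: rat fps)"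
proof -
  define c :: "rat fps" where "c = Abs_fps (\<lambda>k. of_int (central k))"
  have "(1 + 4 * fps_X) * fps_deriv c = - 2 * c"
  proof (rule fps_ext)
    fix k
    have "((1 + 4 * fps_X) * fps_deriv c) $ k = of_int (int (Suc k) * central (Suc k)) + 4 * of_int (int k * central k)"
      by (cases k) (simp_all add: c_def distrib_right mult.assoc numeral_fps_const)
    also have "\<dots> = (- 2 * c) $ k"
      unfolding central_Suc by (simp add: c_def numeral_fps_const algebra_simps)
    finally show "((1 + 4 * fps_X) * fps_deriv c) $ k = (- 2 * c) $ k" .
  qed
  moreover have "fps_deriv (c\<^sup>2 * (1 + 4 * fps_X)) = 2 * c * ((1 + 4 * fps_X) * fps_deriv c) + 4 * c\<^sup>2"
    by (simp add: power2_eq_square algebra_simps)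
  ultimately have "fps_deriv (c\<^sup>2 * (1 + 4 * fps_X)) = 0" by Groebner_Basis.algebra
  hence "c\<^sup>2 * (1 + 4 * fps_X) = fps_const ((c\<^sup>2 * (1 + 4 * fps_X)) $ 0)"
    by (simp only: fps_deriv_eq_0_iff)
  thus ?thesis by (simp add: c_def fps_nth_power_0)
qed

lemma serA_central: "serA = Abs_fps (\<lambda>k. of_int (central k)) oo fps_X ^ 4"
proof (rule fps_ext)
  fix n :: nat
  have "Suc n mod 4 = 1 \<longleftrightarrow> 4 dvd n" "4 dvd n \<Longrightarrow> Suc n div 4 = n div 4" by presburger+
  thus "serA $ n = (Abs_fps (\<lambda>k. of_int (central k)) oo fps_X ^ 4) $ n"
    unfolding fps_nth_compose_X_power serA_def coeffA_def by simp
qed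

lemma serA_square: "serA\<^sup>2 * (1 + 4 * fps_X ^ 4) = 1"
proof -
  have "(Abs_fps (\<lambda>k. of_int (central k)) ^ 2 * (1 + 4 * fps_X)) oo fps_X ^ 4 = (1 :: rat fps)"
    by (simp only: central_series fps_compose_1)
  thus ?thesis
    unfolding serA_central
    by (simp add: compose_X_power_mult compose_X_power_power fps_compose_add_distrib numeral_fps_const)
qed

text \<open>Splits off the constant term of \<open>serA\<close>, the part that produces the pole of
  F.\<close>

lemma serA_serB: "serA = 1 - fps_X\<^sup>2 * serB"
proof (rule fps_ext)
  fix n :: nat
  consider "n = 0" | "n = 1" | m where "n = Suc (Suc m)" by (cases n rule: nat.exhaust) (auto, metis not0_implies_Suc)
  thus "serA $ n = (1 - fps_X\<^sup>2 * serB) $ n"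
  proof cases
    case 3
    have "Suc n mod 4 = 1 \<longleftrightarrow> Suc m mod 4 = 3" "Suc m mod 4 = 3 \<Longrightarrow> Suc n div 4 = Suc (Suc m div 4)"
      unfolding 3 by presburger+
    thus ?thesis by (simp add: serA_def serB_def coeffA_def coeffB_def fps_X_power_mult_nth 3)
  qed (simp_all add: serA_def coeffA_def fps_X_power_mult_nth)
qed

lemma compose_unif_mult: "a * b oo unif = (a oo unif) * (b oo unif)"
  by (rule fps_compose_mult_distrib) simp

lemma compose_unif_power: "a ^ n oo unif = (a oo unif) ^ n"
  by (simp add: fps_compose_power)

text \<open>\<open>serA\<close> at s and the quotient of \<open>theta_even2\<close> by
  \<open>theta_even\<close> have equal squares by \<open>unif_curve\<close>; constant terms settle
  the sign.\<close>

lemma g_fps_serA: "g_fps = (serA oo unif) * (fps_X * fps_deriv unif)"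
proof -
  let ?d = "serA oo unif"
  have "(serA\<^sup>2 * (1 + 4 * fps_X ^ 4)) oo unif = 1"
    by (simp only: serA_square fps_compose_1)
  hence d: "?d\<^sup>2 * (1 + 4 * unif ^ 4) = 1"
    by (simp add: compose_unif_mult compose_unif_power fps_compose_add_distrib numeral_fps_const)
  have "(?d * theta_even)\<^sup>2 = theta_even2\<^sup>2" using d unif_curve by Groebner_Basis.algebra
  hence "?d * theta_even = theta_even2 \<or> ?d * theta_even = - theta_even2" by (simp add: power2_eq_iff)
  moreover have fibre0: "{x \<in> {b::int. even b}. nat (x\<^sup>2) = 0} = {0}" "{x \<in> {b::int. even b}. nat (2 * x\<^sup>2) = 0} = {0}"
    by auto
  have "theta_even $ 0 = 1" "theta_even2 $ 0 = 1" unfolding theta_even_def theta_even2_def gen_fun_nth by (subst fibre0, simp)+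
  hence "(?d * theta_even) $ 0 = 1" "(- theta_even2) $ 0 = -1" by (simp_all add: serA_def coeffA_def)
  ultimately have d': "?d * theta_even = theta_even2" by force
  have "theta_even \<noteq> 0" using \<open>theta_even $ 0 = 1\<close> by auto
  moreover have "theta_even * g_fps = theta_even * (?d * (fps_X * fps_deriv unif))"
    using g_fps_thC unfolding d'[symmetric] by (simp only: mult_ac)
  ultimately show ?thesis by simp
qed

lemma E_eq: "k > 0 \<Longrightarrow> E k = fps_to_fls (euler_at k)"
  unfolding E_def euler_at_def by (rule fls_compose_power_fps_to_fls)

lemma g_eq: "g = fps_to_fls g_fps"
  by (simp add: g_def E_eq g_fps_def fls_times_fps_to_fls fps_to_fls_power)

lemma L_unif: "fls_compose_power L 2 * fps_to_fls unif ^ 2 = 1"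
proof -
  let ?C = "\<lambda>f::rat fls. fls_compose_power f 2"
  have nz: "E 4 \<noteq> 0" "E 8 \<noteq> 0" "E 16 \<noteq> 0" "E 32 \<noteq> 0" by (simp_all add: E_eq)
  have CE: "?C (E k) = E (2 * k)" if "k > 0" for k
    using that by (simp add: E_eq fls_compose_power_fps_to_fls euler_at_compose mult.commute)
  have "L * (E 4 ^ 2 * E 16 ^ 4) = fls_X_inv * E 8 ^ 6" using nz by (simp add: L_def)
  hence "?C (L * (E 4 ^ 2 * E 16 ^ 4)) = ?C (fls_X_inv * E 8 ^ 6)" by simp
  \<comment> \<open>\<open>fls_shift 2 1\<close> is q^(-2), the image of \<open>fls_X_inv\<close>
    under q to q^2.\<close>
  hence CL: "?C L * (E 8 ^ 2 * E 32 ^ 4) = fls_shift 2 1 * E 16 ^ 6"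
    by (simp add: CE)
  have s: "fps_to_fls unif * E 16 ^ 3 = fls_X * E 8 * E 32 ^ 2"
    using arg_cong[OF unif_euler, of fps_to_fls] by (simp add: fls_times_fps_to_fls fps_to_fls_power E_eq)
  have X: "fls_shift 2 1 * fls_X ^ 2 = (1 :: rat fls)"
    by (simp add: fls_X_power_times_conv_shift)
  have "(?C L * fps_to_fls unif ^ 2) * (E 16 ^ 6 * (E 8 ^ 2 * E 32 ^ 4)) = 1 * (E 16 ^ 6 * (E 8 ^ 2 * E 32 ^ 4))"
    using CL s X by Groebner_Basis.algebra
  thus ?thesis using nz by (simp only: mult_cancel_right) simp
qed

lemma F_unif: "F * fps_to_fls unif ^ 2 = - g"
  unfolding F_def using L_unif by (simp add: mult.assoc)

text \<open>In F = -g / s^2 the constant term of \<open>serA\<close> contributes -s^(-2) theta(s),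
  which is theta(1/s); \<open>serB\<close> collects the rest, free of poles.\<close>

lemma F_eq:
  "F = fls_X * fls_deriv (inverse (fps_to_fls unif)) + fps_to_fls ((serB oo unif) * (fps_X * fps_deriv unif))"
proof -
  let ?s = "fps_to_fls unif" and ?b = "fps_to_fls (serB oo unif)"
  have s0: "?s \<noteq> 0" by simp
  have "fls_deriv (?s * inverse ?s) = 0" using s0 by simp
  hence "?s * fls_deriv (inverse ?s) = - (fls_deriv ?s * inverse ?s)"
    unfolding fls_deriv_mult by (simp only: eq_neg_iff_add_eq_0)
  hence "?s * ?s * fls_deriv (inverse ?s) = - fls_deriv ?s" using s0 by (simp add: field_simps)
  moreover have "g = (1 - ?s ^ 2 * ?b) * (fls_X * fls_deriv ?s)"
  proof -
    have "serA oo unif = 1 - unif\<^sup>2 * (serB oo unif)"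
      unfolding serA_serB by (simp add: fps_compose_sub_distrib compose_unif_mult compose_unif_power)
    thus ?thesis unfolding g_eq g_fps_serA
      by (simp add: fls_times_fps_to_fls fps_to_fls_power fls_deriv_fps_to_fls)
  qed
  ultimately have "(fls_X * fls_deriv (inverse ?s) + ?b * (fls_X * fls_deriv ?s)) * ?s ^ 2 = F * ?s ^ 2"
    unfolding F_unif by Groebner_Basis.algebra
  thus ?thesis using s0 by (simp add: fls_times_fps_to_fls fls_deriv_fps_to_fls)
qed

section \<open>Integrality\<close>

definition int_coeffs :: "rat fps \<Rightarrow> bool" where
  "int_coeffs f \<longleftrightarrow> (\<forall>n. f $ n \<in> \<int>)"

lemma int_coeffs_mult: "int_coeffs a \<Longrightarrow> int_coeffs b \<Longrightarrow> int_coeffs (a * b)"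
  by (auto simp: int_coeffs_def fps_mult_nth intro!: Ints_sum Ints_mult)

lemma int_coeffs_power: "int_coeffs a \<Longrightarrow> int_coeffs (a ^ n)"
  by (induction n) (simp_all add: int_coeffs_mult int_coeffs_def[of 1])

lemma int_coeffs_inverse:
  assumes "int_coeffs f" "f $ 0 = 1"
  shows "int_coeffs (inverse f)"
  unfolding int_coeffs_def
proof
  fix n
  show "inverse f $ n \<in> \<int>"
  proof (induction n rule: less_induct)
    case (less n)
    show ?case
    proof (cases "n = 0")
      case False
      have "f * inverse f = 1" using assms(2) by (intro inverse_mult_eq_1') simp
      hence "0 = (\<Sum>i=0..n. f $ i * inverse f $ (n - i))"
        using False by (metis fps_mult_nth fps_one_nth)
      also have "\<dots> = inverse f $ n + (\<Sum>i=1..n. f $ i * inverse f $ (n - i))"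
        using assms(2) by (subst sum.atLeast_Suc_atMost) simp_all
      finally have "inverse f $ n = - (\<Sum>i=1..n. f $ i * inverse f $ (n - i))" by simp
      moreover have "(\<Sum>i=1..n. f $ i * inverse f $ (n - i)) \<in> \<int>"
        using assms(1) less by (intro Ints_sum Ints_mult) (auto simp: int_coeffs_def)
      ultimately show ?thesis by simp
    qed (simp add: assms(2))
  qed
qed

lemma int_coeffs_euler_at: "r > 0 \<Longrightarrow> int_coeffs (euler_at r)"
proof -
  have "int_coeffs (\<Prod>k\<in>{1..n}. 1 - fps_X ^ k)" for n
  proof (induction n)
    case (Suc n)
    have "int_coeffs (1 - fps_X ^ Suc n)" unfolding int_coeffs_def fps_sub_nth fps_X_power_nth by simp
    with Suc show ?case by (simp add: int_coeffs_mult del: power_Suc)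
  qed (simp add: int_coeffs_def)
  thus "r > 0 \<Longrightarrow> int_coeffs (euler_at r)"
    unfolding euler_at_def int_coeffs_def fps_nth_compose_X_power euler_fps_def by simp
qed

lemma int_coeffs_unif: "int_coeffs unif"
proof -
  have "int_coeffs fps_X" by (simp add: int_coeffs_def)
  thus ?thesis unfolding unif_def
    by (intro int_coeffs_mult int_coeffs_power int_coeffs_inverse int_coeffs_euler_at) simp_all
qed

text \<open>Makes the coefficient of q^n in theta(1/s) an integral multiple of n, hence invisible
  modulo p^M when p^M divides n.\<close>

lemma inverse_unif_nth:
  obtains y where "fls_nth (inverse (fps_to_fls unif)) (int n) = of_int y"
proof -
  define u where "u = euler_at 8 * euler_at 32 ^ 2 * inverse (euler_at 16) ^ 3"
  have u: "int_coeffs u" "u $ 0 = 1" unfolding u_def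
    by (intro int_coeffs_mult int_coeffs_power int_coeffs_inverse int_coeffs_euler_at, simp_all)
       (simp add: fps_nth_power_0)
  have "fps_to_fls unif * (fls_X_inv * fps_to_fls (inverse u)) = (fls_X * fls_X_inv) * fps_to_fls (u * inverse u)"
    unfolding unif_def u_def[symmetric] by (simp add: fls_times_fps_to_fls mult_ac)
  also have "\<dots> = 1" using u(2) by (simp add: inverse_mult_eq_1' fls_X_times_conv_shift)
  finally have "inverse (fps_to_fls unif) = fls_X_inv * fps_to_fls (inverse u)"
    by (simp add: inverse_unique)
  hence "fls_nth (inverse (fps_to_fls unif)) (int n) = inverse u $ Suc n"
    by (simp add: fls_X_inv_times_conv_shift nat_add_distrib)
  moreover have "inverse u $ Suc n \<in> \<int>" using int_coeffs_inverse[OF u] by (simp add: int_coeffs_def)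
  ultimately show ?thesis using that by (metis Ints_cases)
qed

lemma inverse_unif_nth_less: "k < -1 \<Longrightarrow> fls_nth (inverse (fps_to_fls unif)) k = 0"
proof -
  assume k: "k < -1"
  have "fls_subdegree (fps_to_fls unif) = 1"
  proof -
    have "subdegree (euler_at 8 * euler_at 32 ^ 2 * inverse (euler_at 16) ^ 3) = 0"
      by (simp add: fps_nth_power_0)
    moreover have "inverse (euler_at 16) \<noteq> 0" using unif_nonzero unfolding unif_def by auto
    ultimately have "subdegree unif = 1" unfolding unif_def by (subst subdegree_mult) auto
    thus ?thesis by (simp add: fls_subdegree_fls_to_fps)
  qed
  hence "fls_subdegree (inverse (fps_to_fls unif)) = -1"
    by (simp add: fls_inverse_subdegree)
  thus ?thesis using k by (intro fls_eq0_below_subdegree) simp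
qed

text \<open>The floor only changes the type, since the coefficients of s are integers; divisibility
  by p says nothing over the rationals.\<close>

definition unif_int :: "int fps" where "unif_int = Abs_fps (\<lambda>n. \<lfloor>unif $ n\<rfloor>)"

definition rat_fps :: "int fps \<Rightarrow> rat fps" where "rat_fps f = Abs_fps (\<lambda>n. of_int (f $ n))"

lemma rat_fps_nth [simp]: "rat_fps f $ n = of_int (f $ n)"
  by (simp add: rat_fps_def)

lemma rat_fps_mult: "rat_fps (a * b) = rat_fps a * rat_fps b"
  by (rule fps_ext) (simp add: fps_mult_nth)

lemma rat_fps_power: "rat_fps (a ^ n) = rat_fps a ^ n"
  by (induction n) (simp_all add: rat_fps_mult fps_eq_iff[of "rat_fps 1"])

lemma rat_fps_X: "rat_fps fps_X = fps_X"
  by (rule fps_ext) simp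

lemma rat_fps_deriv: "rat_fps (fps_deriv a) = fps_deriv (rat_fps a)"
  by (rule fps_ext) simp

lemma unif_int: "rat_fps unif_int = unif"
  using int_coeffs_unif by (intro fps_ext) (auto simp: unif_int_def int_coeffs_def elim!: Ints_cases)

lemma theta_coeff_unif: "theta_coeff unif j n = of_int (theta_coeff unif_int j n)"
proof -
  have "unif ^ (j - 1) * (fps_X * fps_deriv unif) = rat_fps (unif_int ^ (j - 1) * (fps_X * fps_deriv unif_int))"
    by (simp add: rat_fps_mult rat_fps_power rat_fps_X rat_fps_deriv unif_int)
  thus ?thesis by (simp only: theta_coeff_def rat_fps_nth)
qed

text \<open>The index j = i + 1 goes with s^i because s^i ds is the differential of s^j / j. The sum
  stops at n because s^(j-1) theta(s) has no terms below q^j.\<close>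

lemma compose_times_theta_nth:
  fixes s :: "'a::comm_ring_1 fps"
  assumes "s $ 0 = 0"
  shows "((Abs_fps (\<lambda>i. c (Suc i)) oo s) * (fps_X * fps_deriv s)) $ n = (\<Sum>j\<in>{1..n}. c j * theta_coeff s j n)"
proof -
  let ?h = "fps_X * fps_deriv s"
  have pre: "(s ^ i) $ m = 0" if "m < i" for i m
    using startsby_zero_power_prefix[OF assms] that by simp
  have "((Abs_fps (\<lambda>i. c (Suc i)) oo s) * ?h) $ n = (\<Sum>m=0..n. \<Sum>i=0..n. c (Suc i) * ((s ^ i) $ m * ?h $ (n - m)))"
    unfolding fps_mult_nth[of _ ?h] fps_compose_nth
  proof (intro sum.cong refl)
    fix m assume "m \<in> {0..n}"
    have "(\<Sum>i=0..m. Abs_fps (\<lambda>i. c (Suc i)) $ i * (s ^ i) $ m) = (\<Sum>i=0..n. c (Suc i) * (s ^ i) $ m)"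
      using \<open>m \<in> {0..n}\<close> pre by (intro sum.mono_neutral_cong_left) auto
    thus "(\<Sum>i=0..m. Abs_fps (\<lambda>i. c (Suc i)) $ i * (s ^ i) $ m) * ?h $ (n - m) =
        (\<Sum>i=0..n. c (Suc i) * ((s ^ i) $ m * ?h $ (n - m)))"
      by (simp add: sum_distrib_right mult.assoc)
  qed
  also have "\<dots> = (\<Sum>i=0..n. c (Suc i) * (s ^ i * ?h) $ n)"
    by (subst sum.swap) (simp add: fps_mult_nth[of _ ?h] sum_distrib_left)
  also have "\<dots> = (\<Sum>i<n. c (Suc i) * (s ^ i * ?h) $ n) + c (Suc n) * (s ^ n * ?h) $ n"
    by (simp add: atLeast0AtMost lessThan_Suc_atMost[symmetric])
  also have "(s ^ n * ?h) $ n = 0"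
  proof -
    have "(s ^ n) $ m * ?h $ (n - m) = 0" if "m \<le> n" for m
      using pre[of m n] that by (cases "m = n") auto
    thus ?thesis by (simp add: fps_mult_nth[of _ ?h])
  qed
  also have "(\<Sum>i<n. c (Suc i) * (s ^ i * ?h) $ n) = (\<Sum>j\<in>{1..n}. c j * theta_coeff s j n)"
    by (simp add: theta_coeff_def sum.atLeast1_atMost_eq)
  finally show ?thesis by simp
qed

section \<open>Coefficients of g and F as sums over powers of s\<close>

definition g_coeff :: "nat \<Rightarrow> int" where
  "g_coeff n = (\<Sum>i\<in>{1..n}. coeffA i * theta_coeff unif_int i n)"

lemma g_fps_nth: "g_fps $ n = of_int (g_coeff n)"
  unfolding g_fps_serA serA_def g_coeff_def
  by (subst compose_times_theta_nth) (simp_all add: theta_coeff_unif)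

lemma F_nth:
  obtains y where "fls_nth F (int n) = of_int (int n * y + (\<Sum>j\<in>{1..n}. coeffB j * theta_coeff unif_int j n))"
proof -
  obtain y where y: "fls_nth (inverse (fps_to_fls unif)) (int n) = of_int y" by (rule inverse_unif_nth)
  have "fls_nth (fls_X * fls_deriv (inverse (fps_to_fls unif))) (int n) = of_int (int n * y)"
    by (simp add: fls_X_times_conv_shift y)
  moreover have "((serB oo unif) * (fps_X * fps_deriv unif)) $ n =
      of_int (\<Sum>j\<in>{1..n}. coeffB j * theta_coeff unif_int j n)"
    unfolding serB_def by (subst compose_times_theta_nth) (simp_all add: theta_coeff_unif)
  ultimately show ?thesis using that[of y] unfolding F_eq by simp
qed

lemma F_nth_less: "k < -1 \<Longrightarrow> fls_nth F k = 0"
  unfolding F_eq by (simp add: fls_X_times_conv_shift inverse_unif_nth_less)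

section \<open>The Hecke relation at inert primes\<close>

lemma fermat_int:
  fixes a :: int
  assumes "prime p" "\<not> int p dvd a" "even (p - 1)"
  shows "int p dvd a ^ (p - 1) - 1"
proof -
  have "\<not> p dvd nat \<bar>a\<bar>" using assms(2) by (simp add: int_dvd_int_iff[symmetric])
  from fermat_theorem[OF assms(1) this] have "[int (nat \<bar>a\<bar> ^ (p - 1)) = int 1] (mod int p)"
    by (subst cong_int_iff)
  moreover have "int (nat \<bar>a\<bar> ^ (p - 1)) = a ^ (p - 1)"
    using power_even_abs[OF assms(3), of a] by simp
  ultimately have "[a ^ (p - 1) = 1] (mod int p)" by simp
  thus ?thesis by (simp add: cong_iff_dvd_diff)
qed

text \<open>With k = (p - 1)/2 odd, a^2 + b^2 divides a^(2k) + b^(2k), which by Fermat is 2 modulo p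
  if p divides neither a nor b.\<close>

lemma prime_dvd_sum_two_squares:
  fixes a b :: int
  assumes p: "prime p" "p mod 4 = 3" and dvd: "int p dvd a\<^sup>2 + b\<^sup>2"
  shows "int p dvd a"
proof (rule ccontr)
  assume a: "\<not> int p dvd a"
  have pp: "prime (int p)" using p(1) by simp
  have b: "\<not> int p dvd b"
  proof
    assume "int p dvd b"
    hence "int p dvd a\<^sup>2" using dvd by (simp add: power2_eq_square dvd_add_left_iff)
    thus False using a pp prime_dvd_power by blast
  qed
  define k where "k = p div 2"
  have k: "odd k" "p - 1 = 2 * k" using p(2) unfolding k_def by presburger+
  have "a\<^sup>2 - - (b\<^sup>2) dvd (a\<^sup>2) ^ k - (- (b\<^sup>2)) ^ k" by (simp only: power_diff_sumr2 dvd_triv_left)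
  also have "(a\<^sup>2) ^ k - (- (b\<^sup>2)) ^ k = a ^ (p - 1) + b ^ (p - 1)"
    using k(1) by (simp add: k(2)[unfolded One_nat_def] power_mult)
  finally have sum: "int p dvd a ^ (p - 1) + b ^ (p - 1)" using dvd by (metis diff_minus_eq_add dvd_trans)
  have ev: "even (p - 1)" unfolding k(2) by simp
  have fermat: "int p dvd a ^ (p - 1) - 1" "int p dvd b ^ (p - 1) - 1"
    by (rule fermat_int[OF p(1) a ev], rule fermat_int[OF p(1) b ev])
  have "int p dvd (a ^ (p - 1) + b ^ (p - 1)) - (a ^ (p - 1) - 1) - (b ^ (p - 1) - 1)"
    by (rule dvd_diff[OF dvd_diff[OF sum fermat(1)] fermat(2)])
  also have "(a ^ (p - 1) + b ^ (p - 1)) - (a ^ (p - 1) - 1) - (b ^ (p - 1) - 1) = 2" by simp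
  finally have "int p \<le> 2" by (rule zdvd_imp_le) simp
  hence "p = 0 \<or> p = 1 \<or> p = 2" by linarith
  thus False using p(2) by auto
qed

text \<open>In terms of the Gaussian integers \<open>\<alpha> = c + b i\<close> the coefficient is a sum over \<open>\<alpha>\<close> of
  norm \<open>n\<close>; as \<open>p\<close> is inert, the elements of norm \<open>p\<^sup>2 n\<close> are the \<open>- p \<alpha>\<close>.\<close>

lemma hecke_square:
  assumes p: "prime p" "p mod 4 = 3"
  shows "g_coeff (p\<^sup>2 * n) = - int p * g_coeff n"
proof -
  let ?A = "{c::int. c mod 4 = 1} \<times> {b::int. even b}"
  let ?h = "\<lambda>z::int\<times>int. nat ((fst z)\<^sup>2) + nat ((snd z)\<^sup>2)"
  let ?w = "\<lambda>z::int\<times>int. of_int (fst z) * alt (snd z div 2)"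
  let ?F = "\<lambda>n. {z \<in> ?A. ?h z = n}"
  have nth: "of_int (g_coeff m) = (\<Sum>z\<in>?F m. ?w z)" for m
    unfolding g_fps_nth[symmetric] g_fps_theta theta_odd_weighted_def theta_even_alt_def
    by (subst gen_fun_mult) (simp_all add: finite_fibres_square1 gen_fun_nth)
  have h: "?h z = m \<longleftrightarrow> (fst z)\<^sup>2 + (snd z)\<^sup>2 = int m" for z m
    by (simp flip: nat_add_distrib) (simp add: nat_eq_iff)
  have odd: "odd p" and p4: "int p mod 4 = 3" using p(2) by presburger+
  have p0: "p > 0" using p(1) prime_gt_0_nat by blast
  have neg: "(- int p * c) mod 4 = c mod 4" for c
  proof -
    obtain d where d: "int p = 4 * d + 3" using p4 by (metis mult_div_mod_eq)
    have "- int p * c = c + 4 * (- (d + 1) * c)" by (simp add: d algebra_simps)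
    thus ?thesis by (metis mod_mult_self2)
  qed
  \<comment> \<open>Since -p = 1 (mod 4), the minus sign keeps the first coordinate in the class 1
    modulo 4; it is the origin of the factor -p. The weight ignores the sign of the second
    coordinate.\<close>
  have bij: "bij_betw (\<lambda>z. (- int p * fst z, int p * snd z)) (?F n) (?F (p\<^sup>2 * n))"
  proof (rule bij_betw_imageI)
    show "inj_on (\<lambda>z. (- int p * fst z, int p * snd z)) (?F n)"
      using p0 by (auto simp: inj_on_def)
    show "(\<lambda>z. (- int p * fst z, int p * snd z)) ` ?F n = ?F (p\<^sup>2 * n)"
    proof (intro equalityI subsetI)
      fix y assume "y \<in> (\<lambda>z. (- int p * fst z, int p * snd z)) ` ?F n"
      then obtain z where z: "z \<in> ?F n" "y = (- int p * fst z, int p * snd z)" by blast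
      obtain a b where "z = (a, b)" by (cases z)
      with z have ab: "y = (- int p * a, int p * b)" "a mod 4 = 1" "even b" "a\<^sup>2 + b\<^sup>2 = int n"
        unfolding h by auto
      have "(- int p * a)\<^sup>2 + (int p * b)\<^sup>2 = (int p)\<^sup>2 * (a\<^sup>2 + b\<^sup>2)"
        by (simp add: power_mult_distrib algebra_simps)
      hence "(- int p * a)\<^sup>2 + (int p * b)\<^sup>2 = int (p\<^sup>2 * n)" by (simp add: ab(4))
      moreover have "(- int p * a) mod 4 = 1" unfolding neg by (rule ab(2))
      ultimately show "y \<in> ?F (p\<^sup>2 * n)" using ab(1,3) unfolding h by simp
    next
      fix y assume y: "y \<in> ?F (p\<^sup>2 * n)"
      obtain a b where ab: "y = (a, b)" by (cases y)
      have y': "a mod 4 = 1" "even b" "a\<^sup>2 + b\<^sup>2 = int (p\<^sup>2 * n)" using y unfolding h ab by auto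
      have "int p dvd a\<^sup>2 + b\<^sup>2" unfolding y'(3) by (simp add: power2_eq_square)
      moreover have "b\<^sup>2 + a\<^sup>2 = a\<^sup>2 + b\<^sup>2" by (rule add.commute)
      ultimately have "int p dvd a" "int p dvd b"
        using prime_dvd_sum_two_squares[OF p] by metis+
      then obtain c d where cd: "a = int p * c" "b = int p * d" by (auto elim!: dvdE)
      have "(int p)\<^sup>2 * (c\<^sup>2 + d\<^sup>2) = (int p)\<^sup>2 * int n"
        using y'(3) unfolding cd by (simp add: power_mult_distrib algebra_simps)
      hence "(- c)\<^sup>2 + d\<^sup>2 = int n" using p0 by simp
      moreover have "(- c) mod 4 = 1" using neg[of "- c"] y'(1) unfolding cd by simp
      moreover have "even d" using y'(2) odd unfolding cd by simp
      ultimately have "(- c, d) \<in> ?F n" unfolding h by simp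
      thus "y \<in> (\<lambda>z. (- int p * fst z, int p * snd z)) ` ?F n"
        by (rule rev_image_eqI) (simp add: ab cd)
    qed
  qed
  have w: "?w (- int p * fst z, int p * snd z) = - of_nat p * ?w z" if "z \<in> ?F n" for z
  proof -
    have "even (snd z)" using that by auto
    then obtain d where d: "snd z = 2 * d" by (elim evenE)
    have "int p * snd z div 2 = int p * d" by (simp add: d)
    thus ?thesis using odd by (simp add: d alt_def)
  qed
  have "of_int (g_coeff (p\<^sup>2 * n)) = (\<Sum>z\<in>?F n. ?w (- int p * fst z, int p * snd z))"
    unfolding nth by (rule sum.reindex_bij_betw[OF bij, of ?w, symmetric])
  also have "\<dots> = - of_nat p * (\<Sum>z\<in>?F n. ?w z)"
    unfolding sum_distrib_left by (intro sum.cong refl w)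
  also have "\<dots> = of_int (- int p * g_coeff n)" unfolding nth[symmetric] by simp
  finally show ?thesis by (simp only: of_int_eq_iff)
qed

lemma hecke_power:
  assumes p: "prime p" "p mod 4 = 3"
  shows "g_coeff (p ^ (2 * m) * n) = (- int p) ^ m * g_coeff n"
proof (induction m)
  case (Suc m)
  have "p ^ (2 * Suc m) * n = p\<^sup>2 * (p ^ (2 * m) * n)" by (simp add: power2_eq_square mult_ac)
  hence "g_coeff (p ^ (2 * Suc m) * n) = - int p * ((- int p) ^ m * g_coeff n)"
    by (simp only: hecke_square[OF p] Suc.IH)
  thus ?case by simp
qed simp

lemma g_coeff_1: "g_coeff 1 = 1"
proof -
  have "g_fps $ 1 = 1" by (simp add: g_fps_def mult.assoc fps_nth_power_0)
  thus ?thesis unfolding g_fps_nth by simp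
qed

section \<open>Valuations\<close>

lemma vp_of_int_divide:
  assumes p: "prime p" and ab: "a \<noteq> 0" "b \<noteq> 0"
  shows "vp p (of_int a / of_int b) = int (multiplicity (int p) a) - int (multiplicity (int p) b)"
proof -
  let ?x = "of_int a / of_int b :: rat"
  obtain c d where cd: "quotient_of ?x = (c, d)" by (cases "quotient_of ?x")
  have d: "d > 0" by (rule quotient_of_denom_pos[OF cd])
  have x: "?x = of_int c / of_int d" by (rule quotient_of_div[OF cd])
  have "of_int (c * b) = (of_int (a * d) :: rat)" using x ab d by (simp add: field_simps)
  hence eq: "c * b = a * d" by (simp only: of_int_eq_iff)
  hence c: "c \<noteq> 0" using ab d by auto
  have pp: "prime_elem (int p)" using p by simp
  have "multiplicity (int p) c + multiplicity (int p) b = multiplicity (int p) a + multiplicity (int p) d"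
    using arg_cong[OF eq, of "multiplicity (int p)"] ab c d
    by (simp add: prime_elem_multiplicity_mult_distrib[OF pp])
  thus ?thesis unfolding vp_def cd by simp
qed

lemma vp_of_int:
  assumes "prime p" "a \<noteq> 0"
  shows "vp p (of_int a) = int (multiplicity (int p) a)"
  using vp_of_int_divide[OF assms, of 1] by simp

lemma vp_series_ge:
  assumes "\<And>n. fls_nth f n \<noteq> 0 \<Longrightarrow> int k \<le> vp p (fls_nth f n)"
  shows "ereal (of_nat k) \<le> vp_series p f"
  unfolding vp_series_def
proof (rule INF_greatest)
  fix n assume "n \<in> {n. fls_nth f n \<noteq> 0}"
  hence "int k \<le> vp p (fls_nth f n)" using assms by simp
  thus "ereal (of_nat k) \<le> ereal (of_int (vp p (fls_nth f n)))"
    by (metis ereal_less_eq(3) of_int_le_iff of_int_of_nat_eq)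
qed

text \<open>At such n the exact part of F vanishes modulo p^M, and
  \<open>theta_coeff_congruence\<close> compares the rest with g.\<close>

lemma C_congruence:
  assumes p: "prime p" "p mod 4 = 3" and M: "M > 0"
  obtains \<gamma> where "\<not> int p dvd \<gamma>"
    "\<And>n. p ^ M dvd n \<Longrightarrow> \<exists>z. C (int n) = of_int z \<and> int p ^ M dvd z - \<gamma> * g_coeff (n div p)"
proof -
  have odd: "odd p" using p(2) by presburger
  obtain \<gamma> where \<gamma>: "\<not> int p dvd \<gamma>"
    "\<And>i r. r \<le> M \<Longrightarrow> p ^ r dvd p * i \<Longrightarrow> int p ^ r dvd coeffB (p * i) - \<gamma> * coeffA i"
    using coeff_unit_ratio[OF p M] by blast
  show ?thesis
  proof (rule that[OF \<gamma>(1)])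
    fix n assume n: "p ^ M dvd n"
    let ?S = "\<Sum>j\<in>{1..n}. coeffB j * theta_coeff unif_int j n"
    obtain y where y: "fls_nth F (int n) = of_int (int n * y + ?S)" by (rule F_nth)
    have "int p ^ M dvd ?S - \<gamma> * g_coeff (n div p)"
      unfolding g_coeff_def by (rule theta_coeff_congruence[OF p(1) odd M _ n]) (rule \<gamma>(2))
    moreover have "int p ^ M dvd int n * y" using n by (metis dvd_mult2 of_nat_dvd_iff of_nat_power)
    ultimately have "int p ^ M dvd int n * y + (?S - \<gamma> * g_coeff (n div p))" by (rule dvd_add[rotated])
    thus "\<exists>z. C (int n) = of_int z \<and> int p ^ M dvd z - \<gamma> * g_coeff (n div p)"
      unfolding C_def y by (metis add_diff_eq)
  qed
qed

theorem theorem1p1: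
  fixes p m :: nat
  assumes "prime p" and "p mod 4 = 3"
  shows "C (int (p ^ (2 * m + 1))) \<noteq> 0
       \<and> vp p (C (int (p ^ (2 * m + 1)))) = int m
       \<and> vp_series p (U (p ^ (2 * m + 1)) F / fls_const (C (int (p ^ (2 * m + 1)))) - g)
           \<ge> ereal (of_nat (m + 1))"
proof -
  define M where "M = 2 * m + 1"
  have p0: "p > 0" and p1: "\<not> is_unit (int p)" using assms(1) prime_gt_0_nat by auto
  obtain \<gamma> where \<gamma>: "\<not> int p dvd \<gamma>"
    "\<And>n. p ^ M dvd n \<Longrightarrow> \<exists>z. C (int n) = of_int z \<and> int p ^ M dvd z - \<gamma> * g_coeff (n div p)"
    using C_congruence[OF assms, of M] M_def by auto
  have "\<exists>z. C (int (p ^ M * n)) = of_int z \<and> int p ^ M dvd z - \<gamma> * (- int p) ^ m * g_coeff n" for n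
  proof -
    have "p ^ M * n div p = p ^ (2 * m) * n" using p0 by (simp add: M_def mult.assoc)
    thus ?thesis using \<gamma>(2)[of "p ^ M * n"] hecke_power[OF assms, of m n] by (simp add: mult.assoc)
  qed
  then obtain c where c: "\<And>n. C (int (p ^ M * n)) = of_int (c n)"
    "\<And>n. int p ^ M dvd c n - \<gamma> * (- int p) ^ m * g_coeff n" by metis
  obtain t where "c 1 - \<gamma> * (- int p) ^ m * g_coeff 1 = int p ^ M * t" using c(2)[of 1] by (elim dvdE)
  hence t: "c 1 = \<gamma> * (- int p) ^ m + int p ^ M * t" unfolding g_coeff_1 by simp
  \<comment> \<open>C(p^M) is p^m u, where u is gamma up to sign modulo p, because M - m = m + 1 >
    0.\<close>
  define u where "u = (-1) ^ m * \<gamma> + int p * (int p ^ m * t)"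
  have "(- int p) ^ m = (-1) ^ m * int p ^ m" by (rule power_minus)
  moreover have "int p ^ M = int p ^ m * int p ^ m * int p" by (simp add: M_def mult_2 power_add)
  ultimately have u: "c 1 = int p ^ m * u" unfolding t u_def by (simp add: algebra_simps)
  have pu: "\<not> int p dvd u"
  proof
    assume "int p dvd u"
    hence "int p dvd (-1) ^ m * \<gamma>" unfolding u_def by (simp only: dvd_add_left_iff dvd_triv_left)
    thus False using \<gamma>(1) by (cases "even m") auto
  qed
  have c0: "c 1 \<noteq> 0" using u pu p0 by auto
  have mult: "multiplicity (int p) (c 1) = m"
    using pu p0 unfolding u by (intro multiplicity_eqI) (simp_all add: power_Suc2 del: power_Suc)
  have C1: "C (int (p ^ M)) = of_int (c 1)" using c(1)[of 1] by simp
  have "ereal (of_nat (m + 1)) \<le> vp_series p (U (p ^ M) F / fls_const (C (int (p ^ M))) - g)"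
  proof (rule vp_series_ge)
    fix k assume nz: "fls_nth (U (p ^ M) F / fls_const (C (int (p ^ M))) - g) k \<noteq> 0"
    have nth: "fls_nth (U (p ^ M) F / fls_const (C (int (p ^ M))) - g) k =
        C (int (p ^ M) * k) / of_int (c 1) - fls_nth g k"
    proof -
      have "fls_nth (U (p ^ M) F) k = C (int (p ^ M) * k)"
        using p0 by (simp add: U.rep_eq C_def)
      thus ?thesis unfolding C1 by (simp add: divide_inverse fls_inverse_const)
    qed
    \<comment> \<open>The pole of F does not survive \<open>U\<close>: for negative k the index p^M
      k lies below -1, where F has no terms.\<close>
    have "k \<ge> 0"
    proof (rule ccontr)
      assume k: "\<not> k \<ge> 0"
      have "int (p ^ M) * k \<le> int (p ^ M) * (-1)" using k by (intro mult_left_mono) auto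
      moreover have "int (p ^ M) > 1"
        using prime_gt_1_nat[OF assms(1)] by (simp add: M_def one_less_power del: power_Suc)
      ultimately have "int (p ^ M) * k < -1" by linarith
      hence "C (int (p ^ M) * k) = 0" unfolding C_def by (rule F_nth_less)
      moreover have "fls_nth g k = 0" using k by (simp add: g_eq)
      ultimately show False using nz unfolding nth by simp
    qed
    then obtain n where n: "k = int n" using nonneg_int_cases by blast
    define d where "d = c n - c 1 * g_coeff n"
    have eq: "fls_nth (U (p ^ M) F / fls_const (C (int (p ^ M))) - g) k = of_int d / of_int (c 1)"
      using c(1)[of n] c0 unfolding nth by (simp add: n g_eq g_fps_nth d_def field_simps)
    have d0: "d \<noteq> 0" using nz unfolding eq by auto
    \<comment> \<open>Gamma is eliminated here: p^M divides d, and division by C(p^M) takes away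
      exactly p^m.\<close>
    have "d = (c n - \<gamma> * (- int p) ^ m * g_coeff n) - (c 1 - \<gamma> * (- int p) ^ m * g_coeff 1) * g_coeff n"
      by (simp add: d_def g_coeff_1[unfolded One_nat_def] algebra_simps)
    hence "int p ^ M dvd d" using c(2) by (simp add: dvd_diff dvd_mult2)
    hence "M \<le> multiplicity (int p) d" using d0 p1 by (simp add: power_dvd_iff_le_multiplicity)
    thus "int (m + 1) \<le> vp p (fls_nth (U (p ^ M) F / fls_const (C (int (p ^ M))) - g) k)"
      unfolding eq vp_of_int_divide[OF assms(1) d0 c0] mult by (simp add: M_def)
  qed
  moreover have "C (int (p ^ M)) \<noteq> 0" using c0 unfolding C1 by simp
  moreover have "vp p (C (int (p ^ M))) = int m" unfolding C1 vp_of_int[OF assms(1) c0] mult ..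
  ultimately show ?thesis unfolding M_def by blast
qed

end
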